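(* Let \(G\) be a graph with a tree decomposition of width \(w\) and adhesion \(k\). Then \[\operatorname{tww}(G)\leq 3\cdot 2^{k-1}+\max(w-k-2,0).\]
   Context: A tree decomposition of \(G\) is a pair \((T,\{B_t\}_{t\in V(T)})\) with \(T\) a tree and bags \(B_t\subseteq V(G)\) such that every vertex lies in some bag, the bags containing any fixed vertex form a subtree, and every edge lies within some bag. Its width is \(\max_t|B_t|-1\); its adhesion is the maximum of \(|B_s\cap B_t|\) over edges \(st\in E(T)\). A trigraph is a graph whose edges are partitioned into black and red edges. For distinct vertices \(x,y\), the contraction \(G/xy\) replaces \(x,y\) by a new vertex \(z\), keeps edges not incident to \(x,y\), joins \(z\) by a black edge to every common black neighbour of \(x,y\), and by a red edge to every other vertex adjacent to \(x\) or \(y\). The twin-width \(\operatorname{tww}(G)\) is the minimum, over all sequences of contractions reducing the graph to one vertex, of the maximum red degree occurring. *)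

theory Defs
  imports Complex_Main "Graph_Theory.Graph_Theory"
begin

text \<open>
  Finite simple graphs are the \<^locale>\<open>pair_graph\<close>s of the library: finite, loopless,
  symmetric sets of arcs, with every undirected edge represented by its two orientations.
\<close>

section \<open>Tree decompositions\<close>

text \<open>
  The predicate \<^const>\<open>tree\<close> of the library is meant for oriented trees: in a symmetric digraph
  it counts the walk u, v, u along a single edge as a cycle.  For symmetric simple digraphs, the
  cycles of the underlying undirected graph are those of length at least 3.
  Note that \<^const>\<open>connected\<close> entails nonemptiness.
\<close>

definition undirected_tree :: "('t, 'e) pre_digraph \<Rightarrow> bool" where
  "undirected_tree T \<longleftrightarrow>
     graph T \<and> connected T \<and> \<not> (\<exists>p. pre_digraph.cycle T p \<and> 3 \<le> length p)"

definition tree_decomposition ::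
  "'a pair_pre_digraph \<Rightarrow> 't pair_pre_digraph \<Rightarrow> ('t \<Rightarrow> 'a set) \<Rightarrow> bool" where
  "tree_decomposition G T B \<longleftrightarrow>
     undirected_tree (with_proj T) \<and>
     (\<forall>t \<in> pverts T. B t \<subseteq> pverts G) \<and>
     (\<forall>v \<in> pverts G. \<exists>t \<in> pverts T. v \<in> B t) \<and>
     (\<forall>v \<in> pverts G. undirected_tree (with_proj T \<restriction> {t \<in> pverts T. v \<in> B t})) \<and>
     (\<forall>(u, v) \<in> parcs G. \<exists>t \<in> pverts T. u \<in> B t \<and> v \<in> B t)"

definition td_width :: "'t pair_pre_digraph \<Rightarrow> ('t \<Rightarrow> 'a set) \<Rightarrow> int" where
  "td_width T B = int (Max ((\<lambda>t. card (B t)) ` pverts T)) - 1"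

text \<open>Inserting 0 fixes the adhesion of a decomposition whose tree has no edge to be 0.\<close>

definition td_adhesion :: "'t pair_pre_digraph \<Rightarrow> ('t \<Rightarrow> 'a set) \<Rightarrow> nat" where
  "td_adhesion T B = Max (insert 0 ((\<lambda>(s, t). card (B s \<inter> B t)) ` parcs T))"


section \<open>Trigraphs and twin-width\<close>

record 'a trigraph =
  tverts :: "'a set"
  black :: "'a rel"
  red :: "'a rel"

definition wf_trigraph :: "'a trigraph \<Rightarrow> bool" where
  "wf_trigraph H \<longleftrightarrow>
     pair_graph \<lparr>pverts = tverts H, parcs = black H \<union> red H\<rparr> \<and>
     sym (black H) \<and> sym (red H) \<and> black H \<inter> red H = {}"

definition trigraph_of :: "'a pair_pre_digraph \<Rightarrow> 'a trigraph" where
  "trigraph_of G = \<lparr>tverts = pverts G, black = parcs G, red = {}\<rparr>"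

definition common_black :: "'a trigraph \<Rightarrow> 'a \<Rightarrow> 'a \<Rightarrow> 'a set" where
  "common_black H x y = {u \<in> tverts H - {x, y}. (x, u) \<in> black H \<and> (y, u) \<in> black H}"

definition other_nbrs :: "'a trigraph \<Rightarrow> 'a \<Rightarrow> 'a \<Rightarrow> 'a set" where
  "other_nbrs H x y =
     {u \<in> tverts H - {x, y}. (x, u) \<in> black H \<union> red H \<or> (y, u) \<in> black H \<union> red H}
       - common_black H x y"

definition contract :: "'a trigraph \<Rightarrow> 'a \<Rightarrow> 'a \<Rightarrow> 'a \<Rightarrow> 'a trigraph" where
  "contract H x y z =
     \<lparr>tverts = insert z (tverts H - {x, y}),
      black = {(u, v) \<in> black H. {u, v} \<inter> {x, y} = {}}
                \<union> {z} \<times> common_black H x y \<union> common_black H x y \<times> {z},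
      red = {(u, v) \<in> red H. {u, v} \<inter> {x, y} = {}}
                \<union> {z} \<times> other_nbrs H x y \<union> other_nbrs H x y \<times> {z}\<rparr>"

text \<open>
  The new vertex \<open>z\<close> only has to differ from the remaining vertices, so it may reuse one of the
  two names \<open>x\<close>, \<open>y\<close> just removed.  Up to isomorphism the choice of \<open>z\<close> is irrelevant, and with
  this convention a vertex \<open>z\<close> is available even if the vertices exhaust the type.
\<close>

definition contraction_step :: "'a trigraph \<Rightarrow> 'a trigraph \<Rightarrow> bool" where
  "contraction_step H H' \<longleftrightarrow>
     (\<exists>x y z. x \<in> tverts H \<and> y \<in> tverts H \<and> x \<noteq> y \<and> z \<notin> tverts H - {x, y} \<and>
        H' = contract H x y z)"

definition contraction_sequence :: "'a pair_pre_digraph \<Rightarrow> 'a trigraph list \<Rightarrow> bool" where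
  "contraction_sequence G Hs \<longleftrightarrow>
     Hs \<noteq> [] \<and> hd Hs = trigraph_of G \<and> successively contraction_step Hs \<and>
     card (tverts (last Hs)) = 1"

definition red_degree :: "'a trigraph \<Rightarrow> 'a \<Rightarrow> nat" where
  "red_degree H v = card {u. (v, u) \<in> red H}"

definition max_red_degree :: "'a trigraph list \<Rightarrow> nat" where
  "max_red_degree Hs = Max (\<Union>H \<in> set Hs. red_degree H ` tverts H)"

definition tww :: "'a pair_pre_digraph \<Rightarrow> nat" where
  "tww G = (LEAST d. \<exists>Hs. contraction_sequence G Hs \<and> max_red_degree Hs = d)"


section \<open>Well-definedness\<close>

lemma wf_trigraph_iff:
  "wf_trigraph H \<longleftrightarrow>
     finite (tverts H) \<and> black H \<union> red H \<subseteq> tverts H \<times> tverts H \<and> irrefl (black H \<union> red H) \<and>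
     sym (black H) \<and> sym (red H) \<and> black H \<inter> red H = {}" (is "?L = ?R")
proof
  assume ?L
  then interpret pair_graph "\<lparr>pverts = tverts H, parcs = black H \<union> red H\<rparr>"
    by (simp add: wf_trigraph_def)
  show ?R
    using \<open>?L\<close> pair_finite_verts arc_fst_in_verts arc_snd_in_verts pair_no_loops
    by (fastforce simp: wf_trigraph_def irrefl_def)
next
  assume R: ?R
  then have "finite (black H \<union> red H)"
    by (meson finite_SigmaI finite_subset)
  with R have "pair_graph \<lparr>pverts = tverts H, parcs = black H \<union> red H\<rparr>"
    by unfold_locales (auto simp: irrefl_def symmetric_def intro: sym_Un)
  with R show ?L by (simp add: wf_trigraph_def)
qed

lemma wf_trigraph_of:
  assumes "pair_graph G"
  shows "wf_trigraph (trigraph_of G)"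
proof -
  interpret pair_graph G by (fact assms)
  show ?thesis
    using assms pair_sym_arcs
    by (cases G) (simp add: wf_trigraph_def trigraph_of_def symmetric_def sym_def)
qed

lemma wf_trigraph_contraction_step:
  assumes "wf_trigraph H" "contraction_step H H'"
  shows "wf_trigraph H'"
proof -
  obtain x y z where *: "x \<in> tverts H" "y \<in> tverts H" "x \<noteq> y" "z \<notin> tverts H - {x, y}"
    and H': "H' = contract H x y z"
    using assms(2) by (auto simp: contraction_step_def)
  have C: "common_black H x y \<subseteq> tverts H - {x, y}" "other_nbrs H x y \<subseteq> tverts H - {x, y}"
    "common_black H x y \<inter> other_nbrs H x y = {}"
    by (auto simp: common_black_def other_nbrs_def)
  have W: "finite (tverts H)" "black H \<union> red H \<subseteq> tverts H \<times> tverts H" "irrefl (black H \<union> red H)"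
     "sym (black H)" "sym (red H)" "black H \<inter> red H = {}"
    using assms(1) by (simp_all add: wf_trigraph_iff)
  have "black H' \<union> red H' \<subseteq> tverts H' \<times> tverts H'"
    using C W(2) unfolding H' contract_def by auto
  moreover have "irrefl (black H' \<union> red H')"
    using C W(3) * unfolding H' contract_def irrefl_def by auto
  moreover have "sym (black H')" "sym (red H')"
    using W(4,5) unfolding H' contract_def by (auto simp: sym_def)
  moreover have "black H' \<inter> red H' = {}"
    using C W(2,6) * unfolding H' contract_def by auto
  ultimately show ?thesis
    using W(1) by (simp add: wf_trigraph_iff H' contract_def)
qed

lemma contraction_sequence_exists:
  assumes "pair_graph G" "pverts G \<noteq> {}"
  shows "\<exists>Hs. contraction_sequence G Hs"
proof -
  have "\<exists>Hs. Hs \<noteq> [] \<and> hd Hs = H \<and> successively contraction_step Hs \<and> card (tverts (last Hs)) = 1"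
    if "finite (tverts H)" "tverts H \<noteq> {}" for H :: "'a trigraph"
    using that
  proof (induction "card (tverts H)" arbitrary: H rule: less_induct)
    case less
    show ?case
    proof (cases "card (tverts H) = 1")
      case True
      then show ?thesis by (intro exI[of _ "[H]"]) simp
    next
      case False
      with less.prems obtain x y where xy: "x \<in> tverts H" "y \<in> tverts H" "x \<noteq> y"
        by (metis is_singletonI' is_singleton_altdef)
      let ?H = "contract H x y x"
      have v: "tverts ?H = tverts H - {y}"
        using xy by (auto simp: contract_def)
      have "card (tverts ?H) < card (tverts H)"
        unfolding v using xy less.prems by (meson card_Diff1_less)
      moreover have "tverts ?H \<noteq> {}" "finite (tverts ?H)"
        using v xy less.prems by auto
      ultimately obtain Hs where Hs: "Hs \<noteq> []" "hd Hs = ?H" "successively contraction_step Hs"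
          "card (tverts (last Hs)) = 1"
        using less.hyps by blast
      have "contraction_step H ?H"
        unfolding contraction_step_def using xy by blast
      with Hs show ?thesis
        by (intro exI[of _ "H # Hs"]) (simp add: successively_Cons)
    qed
  qed
  from this[of "trigraph_of G"] show ?thesis
    using assms pair_fin_digraph.pair_finite_verts[of G]
    by (auto simp: contraction_sequence_def trigraph_of_def pair_graph_def pair_digraph_def)
qed

end

theory Submission
  imports Defs "HOL-Library.Disjoint_Sets"
begin

text \<open>
  Contract the tree decomposition from its leaves. A set \<open>X\<close> of vertices hanging below a bag is
  contracted until only its twin classes with respect to the outside are left, keeping every part
  homogeneous to every vertex outside \<open>X\<close>, so that no red edge leaves \<open>X\<close>. In the bag, let \<open>D\<close> be
  the private vertices and \<open>S\<close> the vertices shared with the parent. The parts below the bag are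
  treated one after the other: the at most \<open>2^k\<close> twin classes of a part are first merged according
  to their neighbourhood in \<open>S\<close>, which leaves at most \<open>2^(k-1)\<close> of them as the part has a neighbour
  in \<open>D\<close>, and these are merged into at most \<open>2^|S|\<close> accumulated vertices. A vertex of \<open>D\<close> thus sees
  at most \<open>2^k + 2^(k-1)\<close> red neighbours. An accumulated vertex is also red to vertices of \<open>D\<close>; to
  gain the last unit one treats first the parts attached to a fixed vertex \<open>v\<close> of \<open>D\<close> (beginning
  with those whose only neighbour in \<open>D\<close> is \<open>v\<close>) and absorbs \<open>v\<close> before the other parts.
\<close>

section \<open>Partition sequences\<close>

text \<open>Let d be the claimed bound, b = w + 1, s = |S|, m the number of neighbours of the
  current part outside the region, and r the number of vertices of D on the boundary of what has
  been accumulated together with that part. The critical count is that of an accumulated vertex: it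
  is not red to itself and sees at most 2^m - 1 classes of the part, so 2^s + 2^m + r <= d + 2 is
  needed. Since |D| + s <= b and 2^n - n is monotone, 2^s + |D| <= 2^k + b - k. With m = k - 1 and r
  = |D| this gives d + 3 if b >= k + 3, exactly one too much. A part whose only neighbour in D is v
  is harmless because r <= 1, one with a second neighbour in D because m <= k - 2, and every later
  one because v has left the count, so r <= |D| - 1. The vertex v cannot be absorbed at the very
  start: absorbing a part relies on the absence of edges between it and the accumulated vertices,
  which keeps these free of red edges to the part while it still has up to 2^k classes.\<close>

text \<open>
  A trigraph arising from a graph with edges \<open>E\<close> by contractions is represented by the partition
  of the vertices into the sets that have been contracted to one vertex.
\<close>

definition mixed :: "'a rel \<Rightarrow> 'a set \<Rightarrow> 'a set \<Rightarrow> bool" where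
  "mixed E A B \<longleftrightarrow> \<not> A \<times> B \<subseteq> E \<and> A \<times> B \<inter> E \<noteq> {}"

definition red_deg :: "'a rel \<Rightarrow> 'a set set \<Rightarrow> 'a set \<Rightarrow> nat" where
  "red_deg E P A = card {B \<in> P. B \<noteq> A \<and> mixed E A B}"

definition bd :: "'a rel \<Rightarrow> 'a set \<Rightarrow> 'a set" where
  "bd E X = E `` X - X"

text \<open>
  The second conjunct makes every part homogeneous to every vertex outside \<open>X\<close>: no red edge
  leaves \<open>X\<close>.
\<close>

definition good :: "'a rel \<Rightarrow> 'a set \<Rightarrow> nat \<Rightarrow> 'a set set \<Rightarrow> bool" where
  "good E X d P \<longleftrightarrow> partition_on X P \<and>
     (\<forall>A \<in> P. \<forall>a \<in> A. \<forall>a' \<in> A. E `` {a} - X = E `` {a'} - X) \<and>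
     (\<forall>A \<in> P. red_deg E P A \<le> d)"

definition merge :: "'a set set \<Rightarrow> 'a set set \<Rightarrow> bool" where
  "merge P P' \<longleftrightarrow> (\<exists>A \<in> P. \<exists>B \<in> P. A \<noteq> B \<and> P' = insert (A \<union> B) (P - {A, B}))"

text \<open>Goodness is demanded of the partition after each merge. That of the first partition is
  supplied once, for the singletons, which have no red edges at all.\<close>

definition chain :: "'a rel \<Rightarrow> 'a set \<Rightarrow> nat \<Rightarrow> 'a set set \<Rightarrow> 'a set set \<Rightarrow> bool" where
  "chain E X d = (\<lambda>P P'. merge P P' \<and> good E X d P')\<^sup>*\<^sup>*"

text \<open>Describing partitions by colourings turns a merge into a recolouring and a bound on red
  degrees into a count of colours.\<close>

definition classes :: "('a \<Rightarrow> 'c) \<Rightarrow> 'a set \<Rightarrow> 'a set set" where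
  "classes c X = (\<lambda>u. {v \<in> X. c v = c u}) ` X"

text \<open>The target is the coarsest partition of \<open>X\<close> that \<open>good\<close>
  permits, as parts must be homogeneous to the outside. It has at most 2^|\<open>bd E X\<close>|
  parts.\<close>

definition reducible :: "'a rel \<Rightarrow> nat \<Rightarrow> 'a set \<Rightarrow> bool" where
  "reducible E d X \<longleftrightarrow> chain E X d (classes id X) (classes (\<lambda>u. E `` {u} - X) X)"

lemma chain_refl [simp]: "chain E X d P P"
  by (simp add: chain_def)

lemma chain_trans [trans]: "chain E X d P Q \<Longrightarrow> chain E X d Q R \<Longrightarrow> chain E X d P R"
  by (simp add: chain_def)

section \<open>Colour classes and their merging\<close>

lemma partition_on_disjoint_Un:
  assumes "partition_on A P" "partition_on B Q" "A \<inter> B = {}"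
  shows "partition_on (A \<union> B) (P \<union> Q)"
proof (rule partition_onI)
  show "\<Union> (P \<union> Q) = A \<union> B" "{} \<notin> P \<union> Q"
    using assms by (auto simp: partition_on_def)
next
  fix p q assume "p \<in> P \<union> Q" "q \<in> P \<union> Q" "p \<noteq> q"
  then consider "p \<in> P" "q \<in> P" | "p \<in> Q" "q \<in> Q" | "p \<subseteq> A" "q \<subseteq> B" | "p \<subseteq> B" "q \<subseteq> A"
    using assms(1,2) by (auto simp: partition_on_def)
  then show "disjnt p q"
  proof cases
    case 1 then show ?thesis
      using assms(1) \<open>p \<noteq> q\<close> by (simp add: partition_on_def disjoint_def disjnt_def)
  next
    case 2 then show ?thesis
      using assms(2) \<open>p \<noteq> q\<close> by (simp add: partition_on_def disjoint_def disjnt_def)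
  qed (use assms(3) in \<open>auto simp: disjnt_def\<close>)
qed

lemma partition_on_classes: "partition_on X (classes c X)"
  by (auto simp: partition_on_def classes_def disjoint_def)

lemma classes_cong:
  assumes "\<And>u v. u \<in> X \<Longrightarrow> v \<in> X \<Longrightarrow> c u = c v \<longleftrightarrow> c' u = c' v"
  shows "classes c X = classes c' X"
  unfolding classes_def using assms by (intro image_cong) auto

lemma classes_Un:
  assumes "c ` X \<inter> c ` Y = {}"
  shows "classes c (X \<union> Y) = classes c X \<union> classes c Y"
proof -
  have "(\<lambda>u. {v \<in> X \<union> Y. c v = c u}) ` X = (\<lambda>u. {v \<in> X. c v = c u}) ` X"
    using assms by (intro image_cong) auto
  moreover have "(\<lambda>u. {v \<in> X \<union> Y. c v = c u}) ` Y = (\<lambda>u. {v \<in> Y. c v = c u}) ` Y"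
    using assms by (intro image_cong) auto
  ultimately show ?thesis by (simp add: classes_def image_Un)
qed

lemma red_deg_mono:
  assumes "finite Q" "P \<subseteq> Q"
  shows "red_deg E P A \<le> red_deg E Q A"
  unfolding red_deg_def using assms by (intro card_mono) auto

text \<open>\<open>M i\<close> over-approximates the colours whose classes can be red to class
  \<open>i\<close>. Counting colours instead of classes makes it irrelevant which colours occur. A
  mixed pair of classes provides an edge and a non-edge between the same two colours, and this is
  all that \<open>mix\<close> has to examine.\<close>

lemma good_classesI:
  assumes "finite X"
    and tidy: "\<And>u v. u \<in> X \<Longrightarrow> v \<in> X \<Longrightarrow> c u = c v \<Longrightarrow> E `` {u} - X = E `` {v} - X"
    and fin: "\<And>u. u \<in> X \<Longrightarrow> finite (M (c u))"
    and le: "\<And>u. u \<in> X \<Longrightarrow> card (M (c u)) \<le> d"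
    and mix: "\<And>a b a' b'. \<lbrakk>a \<in> X; b \<in> X; a' \<in> X; b' \<in> X; c a' = c a; c b' = c b; c a \<noteq> c b;
      (a, b) \<in> E; (a', b') \<notin> E\<rbrakk> \<Longrightarrow> c b \<in> M (c a)"
  shows "good E X d (classes c X)"
  unfolding good_def
proof (intro conjI ballI)
  show "partition_on X (classes c X)" by (rule partition_on_classes)
next
  fix A a a' assume "A \<in> classes c X" "a \<in> A" "a' \<in> A"
  then show "E `` {a} - X = E `` {a'} - X"
    by (intro tidy) (auto simp: classes_def)
next
  fix A assume "A \<in> classes c X"
  then obtain u where u: "u \<in> X" "A = {v \<in> X. c v = c u}" by (auto simp: classes_def)
  have "{B \<in> classes c X. B \<noteq> A \<and> mixed E A B} \<subseteq> (\<lambda>i. {v \<in> X. c v = i}) ` M (c u)"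
  proof
    fix B assume B: "B \<in> {B \<in> classes c X. B \<noteq> A \<and> mixed E A B}"
    then obtain v where v: "v \<in> X" "B = {x \<in> X. c x = c v}" by (auto simp: classes_def)
    from B obtain a b a' b' where "a \<in> A" "b \<in> B" "a' \<in> A" "b' \<in> B" "(a, b) \<in> E" "(a', b') \<notin> E"
      by (auto simp: mixed_def)
    then have "c b \<in> M (c a)"
      using u v B by (intro mix[of a b a' b']) auto
    then show "B \<in> (\<lambda>i. {v \<in> X. c v = i}) ` M (c u)"
      using \<open>a \<in> A\<close> \<open>b \<in> B\<close> u v by auto
  qed
  then have "red_deg E (classes c X) A \<le> card ((\<lambda>i. {v \<in> X. c v = i}) ` M (c u))"
    unfolding red_deg_def using fin[OF u(1)] by (intro card_mono) auto
  also have "\<dots> \<le> card (M (c u))" using fin[OF u(1)] by (rule card_image_le)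
  also have "\<dots> \<le> d" using le[OF u(1)] .
  finally show "red_deg E (classes c X) A \<le> d" .
qed

text \<open>If both colours occur, recolouring merges exactly two classes; otherwise the partition
  does not change. A phase may therefore run through all conceivable colours, present or
  not.\<close>

lemma chain_recolour:
  assumes c': "\<And>u. u \<in> X \<Longrightarrow> c' u = (if c u = i then j else c u)"
    and good: "good E X d (classes c' X)"
  shows "chain E X d (classes c X) (classes c' X)"
proof (cases "i \<in> c ` X \<and> j \<in> c ` X \<and> i \<noteq> j")
  case False
  then have "classes c X = classes c' X"
    by (intro classes_cong) (auto simp: c' split: if_splits)
  then show ?thesis by simp
next
  case True
  then obtain x y where x: "x \<in> X" "c x = i" and y: "y \<in> X" "c y = j" and "i \<noteq> j" by auto
  define A where "A = {v \<in> X. c v = i}"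
  define B where "B = {v \<in> X. c v = j}"
  have AB: "A \<in> classes c X" "B \<in> classes c X" "A \<noteq> B"
    using x y \<open>i \<noteq> j\<close> by (auto simp: A_def B_def classes_def)
  have split: "X = (A \<union> B) \<union> (X - A - B)" by (auto simp: A_def B_def)
  have "classes c' X = classes c' (A \<union> B) \<union> classes c' (X - A - B)"
    by (subst split, rule classes_Un) (auto simp: A_def B_def c')
  also have "classes c' (A \<union> B) = {A \<union> B}"
    using x y by (force simp: classes_def A_def B_def c')
  also have "classes c' (X - A - B) = classes c (X - A - B)"
    by (intro classes_cong) (auto simp: c' A_def B_def)
  also have "\<dots> = classes c X - {A, B}"
  proof -
    have "classes c X = classes c A \<union> classes c (X - A)"
      using classes_Un[of c A "X - A"] by (auto simp: A_def Un_absorb1)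
    also have "classes c (X - A) = classes c B \<union> classes c (X - A - B)"
    proof -
      have "X - A = B \<union> (X - A - B)" using \<open>i \<noteq> j\<close> by (auto simp: A_def B_def)
      moreover have "c ` B \<inter> c ` (X - A - B) = {}" by (auto simp: A_def B_def)
      ultimately show ?thesis using classes_Un by metis
    qed
    also have "classes c A = {A}" using x by (force simp: classes_def A_def)
    also have "classes c B = {B}" using y by (force simp: classes_def B_def)
    finally have "classes c X = {A} \<union> ({B} \<union> classes c (X - A - B))" .
    moreover have "A \<notin> classes c (X - A - B)" "B \<notin> classes c (X - A - B)"
      using x y by (auto simp: classes_def A_def B_def)
    ultimately show ?thesis by auto
  qed
  finally have "merge (classes c X) (classes c' X)"
    unfolding merge_def using AB by auto
  with good show ?thesis by (auto simp: chain_def)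
qed

lemma chain_finite_induct:
  assumes "finite K"
    and "\<And>U n. insert n U \<subseteq> K \<Longrightarrow> n \<notin> U \<Longrightarrow> chain E X d (C U) (C (insert n U))"
  shows "chain E X d (C {}) (C K)"
  using assms
proof (induction K)
  case (insert x F)
  have "chain E X d (C {}) (C F)"
    using insert.prems by (intro insert.IH) blast
  also have "chain E X d (C F) (C (insert x F))"
    using insert by blast
  finally show ?case .
qed simp

text \<open>No red edge ever joins \<open>Y\<close> to the rest: a singleton outside
  \<open>Y\<close> sees each part of \<open>Y\<close> homogeneously by the definition of
  \<open>good\<close>, and every other part of \<open>R\<close> has no edge to \<open>Y\<close>. Red
  degrees are thus those of the two halves taken separately.\<close>

lemma chain_lift:
  assumes "chain E Y d P Q" and "partition_on Y P" and "sym E"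
    and fin: "finite X" and "Y \<subseteq> X" and R: "partition_on (X - Y) R"
    and away: "\<And>B. B \<in> R \<Longrightarrow> (\<exists>b. B = {b}) \<or> Y \<times> B \<inter> E = {}"
    and tidyR: "\<And>B a a'. B \<in> R \<Longrightarrow> a \<in> B \<Longrightarrow> a' \<in> B \<Longrightarrow> E `` {a} - X = E `` {a'} - X"
    and degR: "\<And>B. B \<in> R \<Longrightarrow> red_deg E R B \<le> d"
  shows "chain E X d (P \<union> R) (Q \<union> R)"
proof -
  have good: "good E X d (P' \<union> R)" if g: "good E Y d P'" for P'
  proof -
    have P': "partition_on Y P'" using g by (simp add: good_def)
    have tidyP: "E `` {a} - Y = E `` {a'} - Y" if "A \<in> P'" "a \<in> A" "a' \<in> A" for A a a'
      using g that unfolding good_def by blast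
    have notmix: "\<not> mixed E A B" "\<not> mixed E B A" if "A \<in> P'" "B \<in> R" for A B
    proof -
      have "A \<subseteq> Y" "B \<subseteq> X - Y" using P' R that by (auto simp: partition_on_def)
      show "\<not> mixed E A B"
      proof (cases "Y \<times> B \<inter> E = {}")
        case True then show ?thesis using \<open>A \<subseteq> Y\<close> by (auto simp: mixed_def)
      next
        case False
        then obtain b where b: "B = {b}" using away[OF \<open>B \<in> R\<close>] by auto
        have "b \<notin> Y" using b \<open>B \<subseteq> X - Y\<close> by auto
        then have "(a, b) \<in> E \<longleftrightarrow> (a', b) \<in> E" if "a \<in> A" "a' \<in> A" for a a'
          using tidyP[OF \<open>A \<in> P'\<close> that] by blast
        then show ?thesis by (auto simp: mixed_def b)
      qed
      moreover have "A \<times> B \<subseteq> E \<longleftrightarrow> B \<times> A \<subseteq> E" "A \<times> B \<inter> E = {} \<longleftrightarrow> B \<times> A \<inter> E = {}"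
        using \<open>sym E\<close> by (auto dest: symD)
      ultimately show "\<not> mixed E B A" by (simp add: mixed_def)
    qed
    have "partition_on X (P' \<union> R)"
      using partition_on_disjoint_Un[OF P' R] \<open>Y \<subseteq> X\<close> by (simp add: Un_absorb1)
    moreover have "E `` {a} - X = E `` {a'} - X" if "A \<in> P' \<union> R" "a \<in> A" "a' \<in> A" for A a a'
    proof (cases "A \<in> P'")
      case True
      show ?thesis using tidyP[OF True that(2,3)] \<open>Y \<subseteq> X\<close> by blast
    next
      case False
      then show ?thesis using that by (intro tidyR[of A]) auto
    qed
    moreover have "red_deg E (P' \<union> R) A \<le> d" if "A \<in> P' \<union> R" for A
    proof (cases "A \<in> P'")
      case True
      then have "{B \<in> P' \<union> R. B \<noteq> A \<and> mixed E A B} = {B \<in> P'. B \<noteq> A \<and> mixed E A B}"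
        using notmix by blast
      then show ?thesis using g True unfolding good_def red_deg_def by simp
    next
      case False
      then have "{B \<in> P' \<union> R. B \<noteq> A \<and> mixed E A B} = {B \<in> R. B \<noteq> A \<and> mixed E A B}"
        using notmix that by blast
      then show ?thesis using degR False that unfolding red_deg_def by simp
    qed
    ultimately show ?thesis unfolding good_def by blast
  qed
  have disj: "P' \<inter> R = {}" if "partition_on Y P'" for P'
  proof -
    have "A = {}" if "A \<in> P'" "A \<in> R" for A
      using that partition_onD1[OF R] partition_onD1[OF \<open>partition_on Y P'\<close>] by blast
    then show ?thesis using partition_onD3[OF R] by blast
  qed
  have "chain E X d (P \<union> R) (Q \<union> R) \<and> partition_on Y Q"
    using assms(1) unfolding chain_def
  proof (induction rule: rtranclp_induct)
    case base then show ?case using assms(2) by simp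
  next
    case (step P' P'')
    from step.hyps(2) obtain A B where AB: "A \<in> P'" "B \<in> P'" "A \<noteq> B" 
      "P'' = insert (A \<union> B) (P' - {A, B})" and g: "good E Y d P''" by (auto simp: merge_def)
    have "A \<notin> R" "B \<notin> R" using disj step.IH AB by blast+
    then have "P'' \<union> R = insert (A \<union> B) (P' \<union> R - {A, B})" using AB by auto
    then have "merge (P' \<union> R) (P'' \<union> R)" using AB unfolding merge_def by blast
    then have "(\<lambda>P P'. merge P P' \<and> good E X d P')\<^sup>*\<^sup>* (P \<union> R) (P'' \<union> R)"
      using good[OF g] step.IH by (blast intro: rtranclp.rtrancl_into_rtrancl)
    then show ?case using g by (simp add: good_def)
  qed
  then show ?thesis by simp
qed

section \<open>Absorbing parts of a region\<close>

text \<open>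
  The partitions of a region \<open>X\<close> occurring in the proof are the colour classes of colourings.
  \<open>Fine N\<close> is the class with neighbourhood \<open>N\<close> outside the current part, \<open>Mid N\<close> and \<open>Acc N\<close> are
  classes with neighbourhood \<open>N\<close> outside \<open>X\<close>, within the current part and among all the vertices
  treated so far, respectively.
\<close>

datatype 'a colour = Acc "'a set" | Mid "'a set" | Fine "'a set" | Single 'a

definition absorbed :: "'a rel \<Rightarrow> 'a set \<Rightarrow> 'a set \<Rightarrow> 'a \<Rightarrow> 'a colour" where
  "absorbed E X A u = (if u \<in> A then Acc (E `` {u} - X) else Single u)"

lemma inj_colours [simp]: "inj_on Acc A" "inj_on Mid A" "inj_on Fine A" "inj_on Single B"
  by (auto simp: inj_on_def)

lemma absorbed_empty: "classes (absorbed E X {}) X = classes id X"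
  by (intro classes_cong) (auto simp: absorbed_def)

lemma absorbed_all: "classes (absorbed E X X) X = classes (\<lambda>u. E `` {u} - X) X"
  by (intro classes_cong) (auto simp: absorbed_def)

lemma card_Pow_le:
  assumes "finite S" shows "card (f ` Pow S) \<le> 2 ^ card S"
  using card_image_le[of "Pow S" f] assms by (simp add: card_Pow)

lemma card_Pow_minus:
  assumes "finite S" "N \<subseteq> S" shows "card (f ` (Pow S - {N})) + 1 \<le> 2 ^ card S"
proof -
  have "card (f ` (Pow S - {N})) \<le> card (Pow S - {N})" using assms by (intro card_image_le) auto
  also have "\<dots> = 2 ^ card S - 1" using assms by (simp add: card_Pow)
  finally show ?thesis using one_le_power[of "2::nat" "card S"] by linarith
qed

lemma card_Un_le3:
  assumes "card A \<le> a" "card B \<le> b" "card C \<le> c"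
  shows "card (A \<union> B \<union> C) \<le> a + b + c"
  using card_Un_le[of "A \<union> B" C] card_Un_le[of A B] assms by linarith

lemma outside_nbrs: "u \<in> X \<Longrightarrow> E `` {u} - X \<subseteq> bd E X"
  by (auto simp: bd_def)

text \<open>The extra unit in \<open>acc\<close> is the class itself, which is not counted among its
  red neighbours. A single vertex can only be red to accumulated classes, and only if it lies on the
  boundary of \<open>A\<close>; hence the premise of \<open>single\<close>.\<close>

lemma good_absorbed:
  assumes "finite X" "finite (bd E X)" "sym E" "A \<subseteq> X"
    and acc: "2 ^ card (bd E X) + card (bd E A \<inter> X) \<le> d + 1"
    and single: "bd E A \<inter> X \<noteq> {} \<Longrightarrow> 2 ^ card (bd E X) \<le> d"
  shows "good E X d (classes (absorbed E X A) X)"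
proof -
  let ?S = "bd E X" and ?R = "bd E A \<inter> X"
  define M where "M = (\<lambda>i. case i of Acc N \<Rightarrow> Acc ` (Pow ?S - {N}) \<union> Single ` ?R
    | Single v \<Rightarrow> (if v \<in> ?R then Acc ` Pow ?S else {}) | _ \<Rightarrow> {})"
  show ?thesis
  proof (rule good_classesI[where M = M])
    fix u v assume "u \<in> X" "v \<in> X" "absorbed E X A u = absorbed E X A v"
    then show "E `` {u} - X = E `` {v} - X" by (auto simp: absorbed_def split: if_splits)
  next
    fix u assume "u \<in> X"
    then show "finite (M (absorbed E X A u))"
      using assms by (auto simp: absorbed_def M_def)
    show "card (M (absorbed E X A u)) \<le> d"
    proof (cases "u \<in> A")
      case True
      have "card (Acc ` (Pow ?S - {E `` {u} - X}) \<union> Single ` ?R :: 'a colour set)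
          \<le> card (Acc ` (Pow ?S - {E `` {u} - X}) :: 'a colour set) + card ?R"
        using card_Un_le[of "Acc ` (Pow ?S - {E `` {u} - X})" "Single ` ?R"]
        by (simp add: card_image)
      then show ?thesis
        using card_Pow_minus[OF assms(2) outside_nbrs[OF \<open>u \<in> X\<close>], where f = Acc] True acc
        by (simp add: absorbed_def M_def)
    next
      case False
      then show ?thesis
        using single le_trans[OF card_Pow_le[OF assms(2), of Acc]]
        by (auto simp: absorbed_def M_def)
    qed
  next
    fix a b a' b' assume h: "a \<in> X" "b \<in> X" "a' \<in> X" "b' \<in> X"
      "absorbed E X A a' = absorbed E X A a" "absorbed E X A b' = absorbed E X A b"
      "absorbed E X A a \<noteq> absorbed E X A b" "(a, b) \<in> E" "(a', b') \<notin> E"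
    have "(b, a) \<in> E" using h(8) assms(3) by (auto dest: symD)
    consider "a \<in> A" "b \<in> A" | "a \<in> A" "b \<notin> A" | "a \<notin> A" "b \<in> A" | "a \<notin> A" "b \<notin> A"
      by blast
    then show "absorbed E X A b \<in> M (absorbed E X A a)"
    proof cases
      case 1
      then show ?thesis using h(7) outside_nbrs[OF h(2), of E] by (simp add: absorbed_def M_def)
    next
      case 2
      then have "b \<in> ?R" using h by (auto simp: bd_def)
      then show ?thesis using 2 by (simp add: absorbed_def M_def)
    next
      case 3
      then have "a \<in> ?R" using h \<open>(b, a) \<in> E\<close> by (auto simp: bd_def)
      then show ?thesis using 3 outside_nbrs[OF h(2), of E] by (simp add: absorbed_def M_def)
    next
      case 4
      then show ?thesis using h(5,6,8,9) by (simp add: absorbed_def split: if_splits)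
    qed
  qed (use assms in auto)
qed

lemma absorb_vertex:
  assumes "finite X" "finite (bd E X)" "sym E" "insert v A \<subseteq> X"
    and "2 ^ card (bd E X) + card (bd E (insert v A) \<inter> X) \<le> d + 1"
    and "bd E (insert v A) \<inter> X \<noteq> {} \<Longrightarrow> 2 ^ card (bd E X) \<le> d"
  shows "chain E X d (classes (absorbed E X A) X) (classes (absorbed E X (insert v A)) X)"
proof (cases "v \<in> A")
  case False
  show ?thesis
  proof (rule chain_recolour[where i = "Single v" and j = "Acc (E `` {v} - X)"])
    show "good E X d (classes (absorbed E X (insert v A)) X)"
      using assms by (intro good_absorbed) auto
  qed (use False in \<open>auto simp: absorbed_def\<close>)
qed (simp add: insert_absorb)

text \<open>The first absorbed vertex stays alone in its class, so this step costs no merge and no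
  bound on red degrees.\<close>

lemma absorb_first_vertex:
  "classes (absorbed E X {v}) X = classes id X"
  by (intro classes_cong) (auto simp: absorbed_def)

text \<open>The four inequalities bound the red degrees of the four kinds of classes, and a class is
  never red to itself: this is the unit in \<open>mid_le\<close> and \<open>fine_le\<close>. The
  second unit in \<open>acc_le\<close> arises because an accumulated class sees at most
  2^|\<open>Q - X\<close>| - 1 intermediate ones: before the first transfer there are no edges
  between \<open>A\<close> and \<open>Y\<close>, after it one intermediate class is gone. The
  premise of \<open>single_le\<close> matters when whole components are glued, where boundaries are
  empty and \<open>d\<close> may be 1.\<close>

locale absorb_region =
  fixes E :: "'a rel" and X A Y :: "'a set" and d :: nat
  assumes finite_X: "finite X" and finite_bd: "finite (bd E X)" "finite (bd E Y)"
    and sym: "sym E"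
    and sub: "A \<subseteq> X" "Y \<subseteq> X" and disj: "A \<inter> Y = {}" and no_edges: "A \<times> Y \<inter> E = {}"
    and red_Y: "reducible E d Y"
    and acc_le: "2 ^ card (bd E X) + 2 ^ card (bd E Y - X) + card (bd E (A \<union> Y) \<inter> X) \<le> d + 2"
    and single_le: "bd E (A \<union> Y) \<inter> X \<noteq> {} \<Longrightarrow> 2 ^ card (bd E X) + 2 ^ card (bd E Y - X) \<le> d"
    and mid_le: "2 ^ card (bd E X) + 2 ^ card (bd E Y - X) + card (bd E Y \<inter> X) \<le> d + 1"
    and fine_le: "2 ^ card (bd E Y) + card (bd E Y \<inter> X) \<le> d + 1"
begin

abbreviation (input) "S \<equiv> bd E X"
abbreviation (input) "Q \<equiv> bd E Y"
abbreviation (input) "R \<equiv> bd E (A \<union> Y) \<inter> X"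

text \<open>\<open>U\<close> records progress: it contains the neighbourhoods outside
  \<open>Y\<close> whose fine class has already been moved. In \<open>to_acc\<close> it contains
  neighbourhoods outside \<open>X\<close>, the labels of the intermediate classes already
  emptied.\<close>

definition to_mid :: "'a set set \<Rightarrow> 'a \<Rightarrow> 'a colour" where
  "to_mid U u = (if u \<in> A then Acc (E `` {u} - X)
     else if u \<in> Y then (if E `` {u} - Y \<in> U then Mid (E `` {u} - X) else Fine (E `` {u} - Y))
     else Single u)"

definition to_acc :: "'a set set \<Rightarrow> 'a \<Rightarrow> 'a colour" where
  "to_acc U u = (if u \<in> A then Acc (E `` {u} - X)
     else if u \<in> Y then (if E `` {u} - X \<in> U then Acc (E `` {u} - X) else Mid (E `` {u} - X))
     else Single u)"

section \<open>Red degrees while one part is absorbed\<close>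

lemma E_sym: "(a, b) \<in> E \<longleftrightarrow> (b, a) \<in> E"
  using sym by (auto dest: symD)

lemma R_eq: "R = (bd E A \<inter> X) \<union> (Q \<inter> X)"
  using no_edges disj E_sym by (fastforce simp: bd_def)

lemma card_bd_A_le: "card (bd E A \<inter> X) \<le> card R"
  using R_eq finite_X by (intro card_mono) auto

lemma bd_A_bounds:
  "2 ^ card S + card (bd E A \<inter> X) \<le> d + 1"
  "bd E A \<inter> X \<noteq> {} \<Longrightarrow> 2 ^ card S \<le> d"
proof -
  have "(1::nat) \<le> 2 ^ card (Q - X)" by simp
  then show "2 ^ card S + card (bd E A \<inter> X) \<le> d + 1"
    using acc_le card_bd_A_le by linarith
  assume "bd E A \<inter> X \<noteq> {}"
  then show "2 ^ card S \<le> d" using single_le R_eq by auto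
qed

lemma nbrs_minus_X: "u \<in> Y \<Longrightarrow> E `` {u} - X = (E `` {u} - Y) - X"
  using sub by auto

lemma nbrs_in_Q_minus_X: "u \<in> Y \<Longrightarrow> E `` {u} - X \<subseteq> Q - X"
  using sub by (auto simp: bd_def)

lemma good_to_mid: "good E X d (classes (to_mid U) X)"
proof -
  \<comment> \<open>\<open>Acc\<close> lists no colour of \<open>Y\<close> because \<open>A\<close>
    and \<open>Y\<close> are not adjacent. \<open>Single\<close> lists no \<open>Fine\<close> colour
    because a fine class is homogeneous to every vertex outside \<open>Y\<close>.\<close>
  define M where "M = (\<lambda>i. case i of Acc N \<Rightarrow> Acc ` (Pow S - {N}) \<union> Single ` R
    | Single v \<Rightarrow> (if v \<in> R then Acc ` Pow S \<union> Mid ` Pow (Q - X) else {})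
    | _ \<Rightarrow> (to_mid U ` Y - {i}) \<union> Single ` (Q \<inter> X))"
  have finY: "finite Y" using finite_X sub(2) by (rule rev_finite_subset)
  \<comment> \<open>At every stage the colour of a vertex of \<open>Y\<close> is determined by its
    neighbourhood outside \<open>Y\<close>, a subset of \<open>Q\<close>.\<close>
  have cY: "card (to_mid U ` Y) \<le> 2 ^ card Q"
  proof -
    have "to_mid U ` Y \<subseteq> (\<lambda>N. if N \<in> U then Mid (N - X) else Fine N) ` Pow Q"
    proof
      fix i assume "i \<in> to_mid U ` Y"
      then obtain u where u: "u \<in> Y" "i = to_mid U u" by blast
      have "u \<notin> A" using disj u by blast
      then have "i = (if E `` {u} - Y \<in> U then Mid ((E `` {u} - Y) - X) else Fine (E `` {u} - Y))"
        using u nbrs_minus_X[OF u(1)] by (simp add: to_mid_def)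
      moreover have "E `` {u} - Y \<in> Pow Q" using outside_nbrs[OF u(1), of E] by blast
      ultimately show "i \<in> (\<lambda>N. if N \<in> U then Mid (N - X) else Fine N) ` Pow Q" by blast
    qed
    then have "card (to_mid U ` Y) \<le> card ((\<lambda>N. if N \<in> U then Mid (N - X) else Fine N) ` Pow Q)"
      using finite_bd by (intro card_mono) auto
    also have "\<dots> \<le> 2 ^ card Q" by (rule card_Pow_le) (use finite_bd in simp)
    finally show ?thesis .
  qed
  show ?thesis
  proof (rule good_classesI[where M = M])
    fix u v assume "u \<in> X" "v \<in> X" "to_mid U u = to_mid U v"
    then show "E `` {u} - X = E `` {v} - X"
      using nbrs_minus_X by (auto simp: to_mid_def split: if_splits)
  next
    fix u assume "u \<in> X"
    then show "finite (M (to_mid U u))"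
      using finite_bd finite_X finY by (auto simp: to_mid_def M_def split: colour.split)
    consider "u \<in> A" | "u \<in> Y" "u \<notin> A" | "u \<notin> A" "u \<notin> Y" by blast
    then show "card (M (to_mid U u)) \<le> d"
    proof cases
      case 1
      have "card (Acc ` (Pow S - {E `` {u} - X}) \<union> Single ` R :: 'a colour set)
          \<le> card (Acc ` (Pow S - {E `` {u} - X}) :: 'a colour set) + card R"
        using card_Un_le[of "Acc ` (Pow S - {E `` {u} - X})" "Single ` R"]
        by (simp add: card_image)
      moreover have "M (to_mid U u) = Acc ` (Pow S - {E `` {u} - X}) \<union> Single ` R"
        using 1 by (simp add: to_mid_def M_def)
      moreover have "(1::nat) \<le> 2 ^ card (Q - X)" by simp
      ultimately show ?thesis
        using card_Pow_minus[OF finite_bd(1) outside_nbrs[OF \<open>u \<in> X\<close>], where f = Acc] acc_le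
        by (elim ssubst) linarith
    next
      case 2
      have "card (M (to_mid U u)) = card ((to_mid U ` Y - {to_mid U u}) \<union> Single ` (Q \<inter> X))"
        using 2 by (auto simp: to_mid_def M_def)
      also have "\<dots> \<le> card (to_mid U ` Y - {to_mid U u}) + card (Q \<inter> X)"
        using card_Un_le[of "to_mid U ` Y - {to_mid U u}" "Single ` (Q \<inter> X)"]
        by (simp add: card_image)
      also have "card (to_mid U ` Y - {to_mid U u}) = card (to_mid U ` Y) - 1"
        using 2 finY by simp
      finally show ?thesis using cY fine_le one_le_power[of "2::nat" "card Q"] by linarith
    next
      case 3
      have "card (Acc ` Pow S \<union> Mid ` Pow (Q - X) :: 'a colour set)
          \<le> 2 ^ card S + 2 ^ card (Q - X)"
        using card_Un_le[of "Acc ` Pow S" "Mid ` Pow (Q - X)"] card_Pow_le[of S Acc]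
          card_Pow_le[of "Q - X" Mid] finite_bd by (simp add: card_image card_Pow)
      then show ?thesis using le_trans[OF _ single_le] 3 by (auto simp: to_mid_def M_def)
    qed
  next
    fix a b a' b' assume h: "a \<in> X" "b \<in> X" "a' \<in> X" "b' \<in> X"
      "to_mid U a' = to_mid U a" "to_mid U b' = to_mid U b" "to_mid U a \<noteq> to_mid U b"
      "(a, b) \<in> E" "(a', b') \<notin> E"
    have ba: "(b, a) \<in> E" "(b', a') \<notin> E" using h E_sym by auto
    have AY: "\<And>x y. x \<in> A \<Longrightarrow> y \<in> Y \<Longrightarrow> (x, y) \<notin> E \<and> (y, x) \<notin> E"
      using no_edges E_sym by blast
    have fine: "(y, x) \<in> E \<longleftrightarrow> (y', x) \<in> E" if "E `` {y} - Y = E `` {y'} - Y" "x \<notin> Y" for x y y'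
      using that by blast
    consider "a \<in> A" "b \<in> A" | "a \<in> A" "b \<notin> A \<union> Y" | "a \<in> Y" "b \<in> Y" "a \<notin> A" "b \<notin> A" 
      | "a \<in> Y" "b \<notin> A \<union> Y" "a \<notin> A"
      | "a \<notin> A \<union> Y" "b \<in> A" | "a \<notin> A \<union> Y" "b \<in> Y" "b \<notin> A" | "a \<notin> A \<union> Y" "b \<notin> A \<union> Y"
      using AY h(8) disj by blast
    then show "to_mid U b \<in> M (to_mid U a)"
    proof cases
      case 1
      then show ?thesis using h outside_nbrs[OF h(2), of E] by (auto simp: to_mid_def M_def)
    next
      case 2
      then show ?thesis using h by (auto simp: to_mid_def M_def bd_def)
    next
      case 3
      then show ?thesis using h by (auto simp: to_mid_def M_def)
    next
      case 4
      then show ?thesis using h by (auto simp: to_mid_def M_def bd_def)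
    next
      case 5
      then have "a \<in> R" using ba h by (auto simp: bd_def)
      moreover have "to_mid U a = Single a" "to_mid U b = Acc (E `` {b} - X)"
        using 5 by (simp_all add: to_mid_def)
      ultimately show ?thesis using outside_nbrs[OF h(2), of E] by (simp add: M_def)
    next
      case 6
      have "a' = a" using 6 h(5) by (auto simp: to_mid_def split: if_splits)
      have "E `` {b} - Y \<in> U"
      proof (rule ccontr)
        assume "E `` {b} - Y \<notin> U"
        then have "E `` {b'} - Y = E `` {b} - Y"
          using 6 h(6) by (auto simp: to_mid_def split: if_splits)
        then show False using fine[of b' b a] ba 6 \<open>a' = a\<close> by auto
      qed
      then have "to_mid U a = Single a" "to_mid U b = Mid (E `` {b} - X)"
        using 6 by (simp_all add: to_mid_def)
      moreover have "a \<in> R" using 6 ba h by (auto simp: bd_def)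
      ultimately show ?thesis using nbrs_in_Q_minus_X[OF 6(2)] by (simp add: M_def)
    next
      case 7
      then show ?thesis using h by (auto simp: to_mid_def split: if_splits)
    qed
  qed (rule finite_X)
qed

lemma good_to_acc:
  assumes U: "U \<subseteq> Pow (Q - X)"
  shows "good E X d (classes (to_acc U) X)"
proof -
  let ?mid = "Mid ` (Pow (Q - X) - U) :: 'a colour set"
  \<comment> \<open>While \<open>U\<close> is empty, all accumulated vertices lie in
    \<open>A\<close> and have no edge to \<open>Y\<close>. Once \<open>U\<close> is nonempty, at
    least one \<open>Mid\<close> colour has disappeared. Either way one of the
    2^|\<open>Q - X\<close>| colours is saved.\<close>
  define M where "M = (\<lambda>i. case i of
      Acc N \<Rightarrow> Acc ` (Pow S - {N}) \<union> (if U = {} then {} else ?mid) \<union> Single ` R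
    | Mid N \<Rightarrow> Acc ` Pow S \<union> Mid ` (Pow (Q - X) - {N}) \<union> Single ` (Q \<inter> X)
    | Single v \<Rightarrow> (if v \<in> R then Acc ` Pow S \<union> Mid ` Pow (Q - X) else {})
    | Fine N \<Rightarrow> {})"
  show ?thesis
  proof (rule good_classesI[where M = M])
    fix u v assume "u \<in> X" "v \<in> X" "to_acc U u = to_acc U v"
    then show "E `` {u} - X = E `` {v} - X"
      by (auto simp: to_acc_def split: if_splits)
  next
    fix u assume "u \<in> X"
    show "finite (M (to_acc U u))"
      using finite_bd finite_X by (auto simp: M_def split: colour.split)
    have Pow1: "(1::nat) \<le> 2 ^ card (Q - X)" by simp
    consider (acc) "to_acc U u = Acc (E `` {u} - X)"
      | (mid) "u \<in> Y" "to_acc U u = Mid (E `` {u} - X)" | (single) "to_acc U u = Single u"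
      by (cases "u \<in> A"; cases "u \<in> Y"; cases "E `` {u} - X \<in> U") (simp_all add: to_acc_def)
    then show "card (M (to_acc U u)) \<le> d"
    proof cases
      case acc
      have "card (if U = {} then {} else ?mid) \<le> 2 ^ card (Q - X) - 1"
      proof (cases "U = {}")
        case False
        then obtain n where "n \<in> U" by auto
        then have "card ?mid \<le> card (Mid ` (Pow (Q - X) - {n}) :: 'a colour set)"
          using finite_bd by (intro card_mono) auto
        then show ?thesis using card_Pow_minus[of "Q - X" n Mid] \<open>n \<in> U\<close> U finite_bd False
          by auto
      qed simp
      then have "card (M (to_acc U u)) \<le> (2 ^ card S - 1) + (2 ^ card (Q - X) - 1) + card R"
        unfolding acc M_def colour.case
        using card_Pow_minus[OF finite_bd(1) outside_nbrs[OF \<open>u \<in> X\<close>], where f = Acc]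
        by (intro card_Un_le3) (simp_all add: card_image)
      then show ?thesis using acc_le Pow1 one_le_power[of "2::nat" "card S"] by linarith
    next
      case mid
      have "card (M (to_acc U u)) \<le> 2 ^ card S + (2 ^ card (Q - X) - 1) + card (Q \<inter> X)"
        unfolding mid(2) M_def colour.case
      proof (intro card_Un_le3)
        show "card (Mid ` (Pow (Q - X) - {E `` {u} - X})) \<le> 2 ^ card (Q - X) - 1"
          using card_Pow_minus[OF finite_Diff[OF finite_bd(2)] nbrs_in_Q_minus_X[OF mid(1)],
              where f = Mid] by linarith
        show "card (Single ` (Q \<inter> X)) \<le> card (Q \<inter> X)"
          by (rule card_image_le) (use finite_X in simp)
      qed (rule card_Pow_le[OF finite_bd(1)])
      then show ?thesis using mid_le Pow1 by linarith
    next
      case single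
      have "card (Acc ` Pow S \<union> Mid ` Pow (Q - X) :: 'a colour set)
          \<le> 2 ^ card S + 2 ^ card (Q - X)"
        using card_Un_le[of "Acc ` Pow S" "Mid ` Pow (Q - X)"] card_Pow_le[of S Acc]
          card_Pow_le[of "Q - X" Mid] finite_bd by (simp add: card_image card_Pow)
      then show ?thesis using le_trans[OF _ single_le] single by (auto simp: M_def)
    qed
  next
    fix a b a' b' assume h: "a \<in> X" "b \<in> X" "a' \<in> X" "b' \<in> X"
      "to_acc U a' = to_acc U a" "to_acc U b' = to_acc U b" "to_acc U a \<noteq> to_acc U b"
      "(a, b) \<in> E" "(a', b') \<notin> E"
    have ba: "(b, a) \<in> E" "(b', a') \<notin> E" using h E_sym by auto
    have AY: "\<And>x y. x \<in> A \<Longrightarrow> y \<in> Y \<Longrightarrow> (x, y) \<notin> E \<and> (y, x) \<notin> E"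
      using no_edges E_sym by blast
    consider "a \<in> A" "b \<in> A" | "a \<in> A" "b \<notin> A \<union> Y" | "a \<in> Y" "b \<in> Y" "a \<notin> A" "b \<notin> A" 
      | "a \<in> Y" "b \<notin> A \<union> Y" "a \<notin> A"
      | "a \<notin> A \<union> Y" "b \<in> A" | "a \<notin> A \<union> Y" "b \<in> Y" "b \<notin> A" | "a \<notin> A \<union> Y" "b \<notin> A \<union> Y"
      using AY h(8) disj by blast
    then show "to_acc U b \<in> M (to_acc U a)"
    proof cases
      case 1
      then show ?thesis using h(7) outside_nbrs[OF h(2), of E] by (simp add: to_acc_def M_def)
    next
      case 2
      then have "b \<in> R" using h(2,8) by (auto simp: bd_def)
      then show ?thesis using 2 by (simp add: to_acc_def M_def)
    next
      case 3
      have "E `` {b} - X \<subseteq> S" "E `` {b} - X \<subseteq> Q - X"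
        using outside_nbrs[OF h(2), of E] nbrs_in_Q_minus_X[OF 3(2)] by simp_all
      then show ?thesis using 3 h(7)
        by (cases "E `` {a} - X \<in> U"; cases "E `` {b} - X \<in> U") (auto simp: to_acc_def M_def)
    next
      case 4
      then have "b \<in> R" "b \<in> Q \<inter> X" using h(2,8) by (auto simp: bd_def)
      then show ?thesis using 4 by (cases "E `` {a} - X \<in> U") (simp_all add: to_acc_def M_def)
    next
      case 5
      then have "a \<in> R" using ba h by (auto simp: bd_def)
      moreover have "to_acc U a = Single a" "to_acc U b = Acc (E `` {b} - X)"
        using 5 by (simp_all add: to_acc_def)
      ultimately show ?thesis using outside_nbrs[OF h(2), of E] by (simp add: M_def)
    next
      case 6
      then have "a \<in> R" using ba h by (auto simp: bd_def)
      moreover have "to_acc U a = Single a"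
        "to_acc U b = (if E `` {b} - X \<in> U then Acc (E `` {b} - X) else Mid (E `` {b} - X))"
        using 6 by (simp_all add: to_acc_def)
      ultimately show ?thesis
        using outside_nbrs[OF h(2), of E] nbrs_in_Q_minus_X[OF 6(2)] by (simp add: M_def)
    next
      case 7
      then show ?thesis using h by (auto simp: to_acc_def split: if_splits)
    qed
  qed (rule finite_X)
qed

text \<open>The reduction of \<open>Y\<close> alone is replayed inside \<open>X\<close>: outside
  \<open>Y\<close> there are only singletons and accumulated classes, and the latter have no edge to
  \<open>Y\<close>.\<close>

lemma chain_to_fine:
  "chain E X d (classes (absorbed E X A) X) (classes (to_mid {}) X)"
proof -
  let ?R = "classes (absorbed E X A) (X - Y)"
  have X: "Y \<union> (X - Y) = X" using sub by auto
  have R: "?R \<subseteq> classes (absorbed E X A) X"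
    using disj sub by (subst X[symmetric], subst classes_Un) (auto simp: absorbed_def)
  have good: "good E X d (classes (absorbed E X A) X)"
    using finite_X finite_bd sym sub bd_A_bounds by (intro good_absorbed) auto
  have "chain E X d (classes id Y \<union> ?R) (classes (\<lambda>u. E `` {u} - Y) Y \<union> ?R)"
  proof (rule chain_lift)
    show "chain E Y d (classes id Y) (classes (\<lambda>u. E `` {u} - Y) Y)"
      using red_Y by (simp add: reducible_def)
  next
    fix B assume "B \<in> ?R"
    then obtain u where u: "u \<in> X - Y" "B = {v \<in> X - Y. absorbed E X A v = absorbed E X A u}"
      by (auto simp: classes_def)
    show "(\<exists>b. B = {b}) \<or> Y \<times> B \<inter> E = {}"
    proof (cases "u \<in> A")
      case True
      then have "B \<subseteq> A" using u by (auto simp: absorbed_def split: if_splits)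
      then show ?thesis using no_edges E_sym by blast
    next
      case False
      then have "B = {u}" using u by (auto simp: absorbed_def)
      then show ?thesis by blast
    qed
  next
    fix B assume "B \<in> ?R"
    have "finite (classes (absorbed E X A) X)" using finite_X by (simp add: classes_def)
    then have "red_deg E ?R B \<le> red_deg E (classes (absorbed E X A) X) B"
      using R by (intro red_deg_mono) auto
    also have "\<dots> \<le> d" using good R \<open>B \<in> ?R\<close> by (auto simp: good_def)
    finally show "red_deg E ?R B \<le> d" .
  next
    fix B a a' assume "B \<in> ?R" "a \<in> B" "a' \<in> B"
    then show "E `` {a} - X = E `` {a'} - X" using good R unfolding good_def by blast
  qed (use finite_X sym sub in \<open>auto intro: partition_on_classes\<close>)
  also have "classes id Y \<union> ?R = classes (absorbed E X A) X"
  proof -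
    have "classes id Y = classes (absorbed E X A) Y"
      using disj by (intro classes_cong) (auto simp: absorbed_def)
    moreover have "classes (absorbed E X A) (Y \<union> (X - Y)) = classes (absorbed E X A) Y \<union> ?R"
      using disj by (intro classes_Un) (auto simp: absorbed_def)
    ultimately show ?thesis using X by simp
  qed
  also have "classes (\<lambda>u. E `` {u} - Y) Y \<union> ?R = classes (to_mid {}) X"
  proof -
    have "classes (\<lambda>u. E `` {u} - Y) Y = classes (to_mid {}) Y"
      using disj by (intro classes_cong) (auto simp: to_mid_def)
    moreover have "?R = classes (to_mid {}) (X - Y)"
      by (intro classes_cong) (auto simp: absorbed_def to_mid_def)
    moreover have "classes (to_mid {}) (Y \<union> (X - Y)) = classes (to_mid {}) Y \<union> classes (to_mid {}) (X - Y)"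
      using disj by (intro classes_Un) (auto simp: to_mid_def split: if_splits)
    ultimately show ?thesis using X by simp
  qed
  finally show ?thesis .
qed

lemma chain_absorb:
  "chain E X d (classes (absorbed E X A) X) (classes (absorbed E X (A \<union> Y)) X)"
proof -
  note chain_to_fine
  also have "chain E X d (classes (to_mid {}) X) (classes (to_mid (Pow Q)) X)"
  proof (rule chain_finite_induct)
    fix U and n :: "'a set" assume n: "n \<notin> U"
    show "chain E X d (classes (to_mid U) X) (classes (to_mid (insert n U)) X)"
    proof (rule chain_recolour[where i = "Fine n" and j = "Mid (n - X)"])
      fix u assume "u \<in> X"
      then show "to_mid (insert n U) u = (if to_mid U u = Fine n then Mid (n - X) else to_mid U u)"
        using n nbrs_minus_X[of u] by (auto simp: to_mid_def)
    qed (rule good_to_mid)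
  qed (use finite_bd in simp)
  also have "classes (to_mid (Pow Q)) X = classes (to_acc {}) X"
    using outside_nbrs[of _ Y E] by (intro classes_cong) (auto simp: to_mid_def to_acc_def)
  also have "chain E X d (classes (to_acc {}) X) (classes (to_acc (Pow (Q - X))) X)"
  proof (rule chain_finite_induct)
    fix U n assume n: "n \<notin> U" "insert n U \<subseteq> Pow (Q - X)"
    show "chain E X d (classes (to_acc U) X) (classes (to_acc (insert n U)) X)"
    proof (rule chain_recolour[where i = "Mid n" and j = "Acc n"])
      fix u assume "u \<in> X"
      then show "to_acc (insert n U) u = (if to_acc U u = Mid n then Acc n else to_acc U u)"
        using n by (auto simp: to_acc_def)
    qed (rule good_to_acc[OF n(2)])
  qed (use finite_bd in simp)
  also have "classes (to_acc (Pow (Q - X))) X = classes (absorbed E X (A \<union> Y)) X"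
    using nbrs_in_Q_minus_X by (intro classes_cong) (auto simp: to_acc_def absorbed_def)
  finally show ?thesis .
qed

end

text \<open>The difference 2^n - n does not decrease. A smaller boundary leaves room for more
  private vertices in the bag, but the exponential saving outweighs them, so the worst case is a
  boundary of size \<open>k\<close>.\<close>

lemma two_power_add_le:
  assumes "s \<le> k" shows "(2::nat) ^ s + k \<le> 2 ^ k + s"
  using assms
proof (induction rule: dec_induct)
  case (step n)
  have "(1::nat) \<le> 2 ^ n" by simp
  then show ?case using step.IH unfolding power_Suc by linarith
qed simp

section \<open>Reducing the region below a bag\<close>

text \<open>By \<open>bd_meets\<close> a part has at most k - 1 neighbours outside \<open>X\<close>,
  which is the source of the summand \<open>2 ^ k div 2\<close>. By \<open>bd_disj\<close> the parts
  are pairwise non-adjacent. The bound \<open>bag_card\<close> reflects that the bag consists of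
  \<open>D\<close> and of shared vertices, which contain the boundary of \<open>X\<close>.\<close>

locale bag_region =
  fixes E :: "'a rel" and D :: "'a set" and F :: "'a set set" and k b :: nat
  assumes finite_E: "finite E" and sym: "sym E"
    and finite_DF: "finite D" "finite F" "\<And>Y. Y \<in> F \<Longrightarrow> finite Y"
    and disj: "\<And>Y. Y \<in> F \<Longrightarrow> Y \<inter> D = {}" "\<And>Y Z. Y \<in> F \<Longrightarrow> Z \<in> F \<Longrightarrow> Y \<noteq> Z \<Longrightarrow> Y \<inter> Z = {}"
    and bd_disj: "\<And>Y Z. Y \<in> F \<Longrightarrow> Z \<in> F \<Longrightarrow> bd E Y \<inter> Z = {}"
    and bd_meets: "\<And>Y. Y \<in> F \<Longrightarrow> bd E Y \<inter> D \<noteq> {}"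
    and bd_card: "\<And>Y. Y \<in> F \<Longrightarrow> card (bd E Y) \<le> k"
    and red_F: "\<And>Y. Y \<in> F \<Longrightarrow> reducible E (2 ^ k + 2 ^ k div 2 + (b - (k + 3))) Y"
    and bd_X_card: "card (bd E (D \<union> \<Union>F)) \<le> k"
    and bag_card: "card D + card (bd E (D \<union> \<Union>F)) \<le> b"
begin

abbreviation (input) "X \<equiv> D \<union> \<Union>F"
abbreviation (input) "d \<equiv> 2 ^ k + 2 ^ k div 2 + (b - (k + 3))"

lemma finite_X: "finite X"
  using finite_DF by auto

lemma finite_bd: "finite (bd E Z)"
  using finite_E unfolding bd_def by (simp add: finite_Image)

lemma bd_Int_X: "Y \<in> F \<Longrightarrow> bd E Y \<inter> X = bd E Y \<inter> D"
  using bd_disj by auto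

text \<open>Parts adjacent to \<open>D'\<close> are in \<open>G\<close> and no two parts are
  adjacent, so a boundary vertex inside \<open>X\<close> cannot lie in a part.\<close>

lemma bd_partial:
  assumes "G \<subseteq> F" "D' \<subseteq> D" and closed: "\<And>Z. Z \<in> F \<Longrightarrow> bd E Z \<inter> D' \<noteq> {} \<Longrightarrow> Z \<in> G"
  shows "bd E (D' \<union> \<Union>G) \<inter> X \<subseteq> D - D'"
proof
  fix v assume v: "v \<in> bd E (D' \<union> \<Union>G) \<inter> X"
  then obtain a where a: "(a, v) \<in> E" "a \<in> D' \<union> \<Union>G" "v \<notin> D' \<union> \<Union>G" by (auto simp: bd_def)
  have "v \<notin> Z" if "Z \<in> F" for Z
  proof
    assume "v \<in> Z"
    then have "Z \<notin> G" using a(3) by blast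
    show False
    proof (cases "a \<in> D'")
      case True
      then have "a \<in> bd E Z"
        using sym a(1) \<open>v \<in> Z\<close> disj(1)[OF that] assms(2) unfolding bd_def by (auto dest: symD)
      then show False using closed[OF that] True \<open>Z \<notin> G\<close> by blast
    next
      case False
      then obtain Z' where "Z' \<in> G" "a \<in> Z'" using a(2) by blast
      then have "v \<in> bd E Z'" using a(1,3) by (auto simp: bd_def)
      then show False using bd_disj[of Z' Z] \<open>Z' \<in> G\<close> assms(1) that \<open>v \<in> Z\<close> by blast
    qed
  qed
  then show "v \<in> D - D'" using v a(3) by blast
qed

lemma k_pos:
  assumes "Y \<in> F" shows "0 < k"
proof -
  have "card (bd E Y) \<noteq> 0" using bd_meets[OF assms] finite_bd[of Y] by auto
  then show ?thesis using bd_card[OF assms] by simp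
qed

lemma two_power_k_halves: "Y \<in> F \<Longrightarrow> (2::nat) ^ k = 2 * (2 ^ k div 2)"
  using k_pos by simp

text \<open>Only the count for accumulated classes depends on the order of treatment and is left as
  the premise \<open>le\<close>. The other inequalities hold for any part, because it has a
  neighbour in \<open>D\<close> and at most \<open>k\<close> neighbours altogether.\<close>

lemma region:
  assumes Y: "Y \<in> F" and G: "G \<subseteq> F" "Y \<notin> G" and D': "D' \<subseteq> D" "bd E Y \<inter> D' = {}"
    and closed: "\<And>Z. Z \<in> F \<Longrightarrow> bd E Z \<inter> D' \<noteq> {} \<Longrightarrow> Z \<in> G"
    and le: "2 ^ card (bd E X) + 2 ^ card (bd E Y - X)
       + card (bd E (D' \<union> \<Union>(insert Y G)) \<inter> X) \<le> d + 2"
  shows "absorb_region E X (D' \<union> \<Union>G) Y d"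
proof -
  let ?s = "card (bd E X)" and ?m = "card (bd E Y - X)" and ?j = "card (bd E Y \<inter> X)"
  have "0 < k" using k_pos[OF Y] .
  have q: "card (bd E Y) = ?m + ?j"
    using finite_bd[of Y] card_Int_Diff[of "bd E Y" X] by linarith
  have "?j \<noteq> 0" using bd_Int_X[OF Y] bd_meets[OF Y] finite_bd[of Y] by auto
  with q have mj: "?m + ?j \<le> k" "1 \<le> ?j" using bd_card[OF Y] by auto
  obtain k' where k': "k = Suc k'" using \<open>0 < k\<close> by (cases k) auto
  have H: "(2::nat) ^ k = 2 * 2 ^ k'" "(2::nat) ^ k div 2 = 2 ^ k'" using k' by simp_all
  have s: "(2::nat) ^ ?s \<le> 2 ^ k" using bd_X_card by (intro power_increasing) auto
  \<comment> \<open>As ?m + ?j <= k, this gives 2^?m + ?j <= 2^(k-1) + 1: neighbours in the bag are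
    paid for by the loss of intermediate classes.\<close>
  have m: "(2::nat) ^ ?m + k' \<le> 2 ^ k' + ?m" using mj k' by (intro two_power_add_le) simp
  then have m': "(2::nat) ^ ?m \<le> 2 ^ k'" using mj k' by linarith
  have Uk: "D' \<union> \<Union>G \<union> Y = D' \<union> \<Union>(insert Y G)" by blast
  show ?thesis
  proof
    show "finite X" by (rule finite_X)
    show "finite (bd E X)" "finite (bd E Y)" by (rule finite_bd)+
    show "sym E" by (rule sym)
    show "D' \<union> \<Union>G \<subseteq> X" "Y \<subseteq> X" using D' G Y by auto
    show "(D' \<union> \<Union>G) \<inter> Y = {}" using disj(1)[OF Y] disj(2)[OF Y] G D' by blast
    show "(D' \<union> \<Union>G) \<times> Y \<inter> E = {}"
    proof -
      have "(a, y) \<notin> E" if "a \<in> D' \<union> \<Union>G" "y \<in> Y" for a y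
      proof
        assume "(a, y) \<in> E"
        have "a \<notin> Y" using \<open>(D' \<union> \<Union>G) \<inter> Y = {}\<close> that by blast
        then have "a \<in> bd E Y" using \<open>(a, y) \<in> E\<close> sym that unfolding bd_def by (auto dest: symD)
        then show False using D' that(1) bd_disj[OF Y] G by blast
      qed
      then show ?thesis by blast
    qed
    show "reducible E d Y" using red_F[OF Y] .
    show "2 ^ ?s + 2 ^ ?m + card (bd E (D' \<union> \<Union>G \<union> Y) \<inter> X) \<le> d + 2"
      unfolding Uk by (rule le)
    show "2 ^ ?s + 2 ^ ?m \<le> d" using s m' H by linarith
    show "2 ^ ?s + 2 ^ ?m + ?j \<le> d + 1" using s m mj k' H by linarith
    have "(2::nat) ^ card (bd E Y) \<le> 2 ^ k" using bd_card[OF Y] by (intro power_increasing) auto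
    moreover have "k' < 2 ^ k'" by simp
    ultimately show "2 ^ card (bd E Y) + ?j \<le> d + 1" using mj k' H by linarith
  qed
qed

lemma chain_family:
  assumes "H \<subseteq> F"
    and "\<And>Y G. Y \<in> H \<Longrightarrow> G \<subseteq> H \<Longrightarrow> Y \<notin> G \<Longrightarrow> absorb_region E X (A \<union> \<Union>G) Y d"
  shows "chain E X d (classes (absorbed E X A) X) (classes (absorbed E X (A \<union> \<Union>H)) X)"
proof -
  have "finite H" using assms(1) finite_DF(2) by (rule finite_subset)
  then have "chain E X d (classes (absorbed E X (A \<union> \<Union>{})) X) (classes (absorbed E X (A \<union> \<Union>H)) X)"
  proof (rule chain_finite_induct)
    fix U Y assume "insert Y U \<subseteq> H" "Y \<notin> U"
    then interpret R: absorb_region E X "A \<union> \<Union>U" Y d by (intro assms(2)) auto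
    have "A \<union> \<Union>(insert Y U) = A \<union> \<Union>U \<union> Y" by blast
    then show "chain E X d (classes (absorbed E X (A \<union> \<Union>U)) X)
        (classes (absorbed E X (A \<union> \<Union>(insert Y U))) X)"
      using R.chain_absorb by simp
  qed
  then show ?thesis by simp
qed

lemma reducible_region: "reducible E d X"
proof (cases "D = {}")
  case True
  then have "F = {}" using bd_meets by auto
  with True show ?thesis by (simp add: reducible_def classes_def)
next
  case False
  then obtain v where v: "v \<in> D" by auto
  let ?c = "\<lambda>A. classes (absorbed E X A) X"
  let ?s = "card (bd E X)"
  define F1 where "F1 = {Y \<in> F. bd E Y \<inter> D = {v}}"
  define F2 where "F2 = {Y \<in> F. v \<in> bd E Y} - F1"
  define F3 where "F3 = F - (F1 \<union> F2)"
  have sub: "F1 \<subseteq> F" "F2 \<subseteq> F" "F3 \<subseteq> F" by (auto simp: F1_def F2_def F3_def)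
  have F3: "v \<notin> bd E Y" if "Y \<in> F3" for Y
    using that by (auto simp: F1_def F2_def F3_def)
  \<comment> \<open>Together with \<open>bag_card\<close> this yields 2^?s + |D| <= 2^k + b - k, the
    estimate behind all the counts below.\<close>
  have s: "(2::nat) ^ ?s + k \<le> 2 ^ k + ?s" by (rule two_power_add_le[OF bd_X_card])
  have "D \<noteq> {}" "finite D" using v finite_DF by auto
  then have D1: "1 \<le> card D" by (simp add: Suc_le_eq card_gt_0_iff)
  have m: "2 * (2::nat) ^ card (bd E Y - X) \<le> 2 ^ k"
    and m2: "2 \<le> card (bd E Y \<inter> D) \<Longrightarrow> 4 * (2::nat) ^ card (bd E Y - X) \<le> 2 ^ k" if "Y \<in> F" for Y
  proof -
    have q: "card (bd E Y) = card (bd E Y \<inter> D) + card (bd E Y - X)"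
      using finite_bd[of Y] card_Int_Diff[of "bd E Y" X] bd_Int_X[OF that] by simp
    have "card (bd E Y \<inter> D) \<noteq> 0" using bd_meets[OF that] finite_bd[of Y] by auto
    then have "(2::nat) ^ Suc (card (bd E Y - X)) \<le> 2 ^ k"
      using q bd_card[OF that] by (intro power_increasing) auto
    then show "2 * (2::nat) ^ card (bd E Y - X) \<le> 2 ^ k" by simp
    assume "2 \<le> card (bd E Y \<inter> D)"
    then have "(2::nat) ^ Suc (Suc (card (bd E Y - X))) \<le> 2 ^ k"
      using q bd_card[OF that] by (intro power_increasing) auto
    then show "4 * (2::nat) ^ card (bd E Y - X) \<le> 2 ^ k" by simp
  qed
  have "chain E X d (?c {}) (?c ({} \<union> \<Union>F1))"
  proof (rule chain_family[OF sub(1)])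
    fix Y G assume Y: "Y \<in> F1" and G: "G \<subseteq> F1" "Y \<notin> G"
    \<comment> \<open>All parts treated so far have \<open>v\<close> as their only neighbour in
      \<open>D\<close>, so the boundary contributes at most 1 however large the bag is.\<close>
    have "bd E ({} \<union> \<Union>(insert Y G)) \<inter> X \<subseteq> {v}"
    proof
      fix u assume "u \<in> bd E ({} \<union> \<Union>(insert Y G)) \<inter> X"
      then obtain Z where Z: "Z \<in> insert Y G" "u \<in> bd E Z \<inter> X" unfolding bd_def by blast
      then have "Z \<in> F" "bd E Z \<inter> D = {v}" using Y G(1) unfolding F1_def by blast+
      then show "u \<in> {v}" using Z(2) bd_Int_X[of Z] by simp
    qed
    then have "card (bd E ({} \<union> \<Union>(insert Y G)) \<inter> X) \<le> card {v}"
      by (intro card_mono) simp_all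
    then have "card (bd E ({} \<union> \<Union>(insert Y G)) \<inter> X) \<le> 1" by simp
    moreover have "(2::nat) ^ ?s \<le> 2 ^ k" using bd_X_card by (intro power_increasing) auto
    moreover have YF: "Y \<in> F" using Y sub by auto
    ultimately have le: "2 ^ ?s + 2 ^ card (bd E Y - X)
        + card (bd E ({} \<union> \<Union>(insert Y G)) \<inter> X) \<le> d + 2"
      using m[OF YF] two_power_k_halves[OF YF] by linarith
    show "absorb_region E X ({} \<union> \<Union>G) Y d"
      by (rule region[OF YF _ _ _ _ _ le]) (use G sub in auto)
  qed
  also have "chain E X d (?c ({} \<union> \<Union>F1)) (?c ({} \<union> \<Union>F1 \<union> \<Union>F2))"
  proof (rule chain_family[OF sub(2)])
    fix Y G assume Y: "Y \<in> F2" and G: "G \<subseteq> F2" "Y \<notin> G"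
    have "bd E ({} \<union> \<Union>(insert Y (F1 \<union> G))) \<inter> X \<subseteq> D - {}"
      using Y G sub by (intro bd_partial) auto
    then have "card (bd E ({} \<union> \<Union>(insert Y (F1 \<union> G))) \<inter> X) \<le> card D"
      using finite_DF(1) by (intro card_mono) auto
    \<comment> \<open>The boundary may be all of \<open>D\<close> here. The second neighbour in
      \<open>D\<close> lowers the number of intermediate classes to at most a quarter of 2^k, and
      the quarter saved is at least the missing unit.\<close>
    moreover have "2 \<le> card (bd E Y \<inter> D)"
    proof -
      have "v \<in> bd E Y \<inter> D" "bd E Y \<inter> D \<noteq> {v}" using Y v by (auto simp: F1_def F2_def)
      then obtain u where "{u, v} \<subseteq> bd E Y \<inter> D" "u \<noteq> v" by blast
      then show ?thesis using card_mono[of "bd E Y \<inter> D" "{u, v}"] finite_DF(1) by simp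
    qed
    moreover have YF: "Y \<in> F" using Y sub by auto
    moreover have "(1::nat) \<le> 2 ^ card (bd E Y - X)" by simp
    ultimately have le: "2 ^ ?s + 2 ^ card (bd E Y - X)
        + card (bd E ({} \<union> \<Union>(insert Y (F1 \<union> G))) \<inter> X) \<le> d + 2"
      using m2[OF YF] two_power_k_halves[OF YF] s bag_card by linarith
    have "Y \<notin> F1 \<union> G" using Y G by (auto simp: F2_def)
    then have "absorb_region E X ({} \<union> \<Union>(F1 \<union> G)) Y d"
      by (intro region[OF YF _ _ _ _ _ le]) (use G sub in auto)
    then show "absorb_region E X ({} \<union> \<Union>F1 \<union> \<Union>G) Y d" by (simp add: Un_assoc)
  qed
  also have "chain E X d \<dots> (?c ({v} \<union> \<Union>(F1 \<union> F2)))"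
  \<comment> \<open>If nothing is attached to \<open>v\<close>, then \<open>k\<close> may be 0 and
    the count of the other case would be one too large, but absorbing \<open>v\<close> as the very
    first vertex is no merge. If something is attached, then k >= 1 and the summand
    \<open>2 ^ k div 2\<close> supplies the unit.\<close>
  proof (cases "F1 \<union> F2 = {}")
    case True
    then show ?thesis
      using absorb_first_vertex[of E X v] absorbed_empty[of E X] by simp
  next
    case False
    then obtain Y where "Y \<in> F" using sub by auto
    have "bd E ({v} \<union> \<Union>(F1 \<union> F2)) \<inter> X \<subseteq> D - {v}"
      using sub v by (intro bd_partial) (auto simp: F2_def)
    then have "card (bd E ({v} \<union> \<Union>(F1 \<union> F2)) \<inter> X) \<le> card (D - {v})"
      using finite_DF(1) by (intro card_mono) auto
    also have "\<dots> = card D - 1" using v finite_DF(1) by simp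
    finally have c: "card (bd E ({v} \<union> \<Union>(F1 \<union> F2)) \<inter> X) \<le> card D - 1" .
    have H: "(2::nat) \<le> 2 ^ k" using m[OF \<open>Y \<in> F\<close>] one_le_power[of "2::nat" "card (bd E Y - X)"]
      by linarith
    have "chain E X d (?c (\<Union>F1 \<union> \<Union>F2)) (?c (insert v (\<Union>F1 \<union> \<Union>F2)))"
    proof (rule absorb_vertex[OF finite_X finite_bd sym])
      show "insert v (\<Union>F1 \<union> \<Union>F2) \<subseteq> X" using v sub by auto
      have "card (bd E (insert v (\<Union>F1 \<union> \<Union>F2)) \<inter> X) \<le> card D - 1"
        using c by (simp add: Union_Un_distrib)
      then show "2 ^ ?s + card (bd E (insert v (\<Union>F1 \<union> \<Union>F2)) \<inter> X) \<le> d + 1"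
        using s bag_card D1 H two_power_k_halves[OF \<open>Y \<in> F\<close>] by linarith
      show "2 ^ ?s \<le> d" using bd_X_card power_increasing[of ?s k "2::nat"] by linarith
    qed
    then show ?thesis by (simp add: Union_Un_distrib)
  qed
  also have "chain E X d \<dots> (?c ({v} \<union> \<Union>(F1 \<union> F2) \<union> \<Union>F3))"
  proof (rule chain_family[OF sub(3)])
    fix Y G assume Y: "Y \<in> F3" and G: "G \<subseteq> F3" "Y \<notin> G"
    have closed: "Z \<in> F1 \<union> F2 \<union> G" if "Z \<in> F" "bd E Z \<inter> {v} \<noteq> {}" for Z G
      using that by (auto simp: F2_def)
    have "bd E ({v} \<union> \<Union>(insert Y (F1 \<union> F2 \<union> G))) \<inter> X \<subseteq> D - {v}"
      using Y G sub v closed by (intro bd_partial) auto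
    then have "card (bd E ({v} \<union> \<Union>(insert Y (F1 \<union> F2 \<union> G))) \<inter> X) \<le> card (D - {v})"
      using finite_DF(1) by (intro card_mono) auto
    also have "\<dots> = card D - 1" using v finite_DF(1) by simp
    finally have c: "card (bd E ({v} \<union> \<Union>(insert Y (F1 \<union> F2 \<union> G))) \<inter> X) \<le> card D - 1" .
    have YF: "Y \<in> F" using Y sub by auto
    have "absorb_region E X ({v} \<union> \<Union>(F1 \<union> F2 \<union> G)) Y d"
    proof (rule region[OF YF])
      show "Y \<notin> F1 \<union> F2 \<union> G" using Y G by (auto simp: F3_def)
      show "bd E Y \<inter> {v} = {}" using F3[OF Y] by simp
      show "2 ^ ?s + 2 ^ card (bd E Y - X)
          + card (bd E ({v} \<union> \<Union>(insert Y (F1 \<union> F2 \<union> G))) \<inter> X) \<le> d + 2"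
        using c m[OF YF] two_power_k_halves[OF YF] s bag_card D1 by linarith
    qed (use G sub v closed in auto)
    then show "absorb_region E X ({v} \<union> \<Union>(F1 \<union> F2) \<union> \<Union>G) Y d"
      by (simp add: Union_Un_distrib Un_assoc)
  qed
  also have "{v} \<union> \<Union>(F1 \<union> F2) \<union> \<Union>F3 = ({v} \<union> {}) \<union> \<Union>F"
    using sub by (auto simp: F3_def)
  also have "chain E X d (?c ({v} \<union> {} \<union> \<Union>F)) (?c ({v} \<union> (D - {v}) \<union> \<Union>F))"
  proof (rule chain_finite_induct[of "D - {v}"])
    fix U u assume u: "insert u U \<subseteq> D - {v}" "u \<notin> U"
    have "bd E (({v} \<union> insert u U) \<union> \<Union>F) \<inter> X \<subseteq> D - ({v} \<union> insert u U)"
      using u v by (intro bd_partial) auto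
    then have "bd E ({v} \<union> insert u U \<union> \<Union>F) \<inter> X \<subseteq> D - {u, v}" by auto
    then have "card (bd E ({v} \<union> insert u U \<union> \<Union>F) \<inter> X) \<le> card (D - {u, v})"
      using finite_DF(1) by (intro card_mono) auto
    \<comment> \<open>Both \<open>u\<close> and \<open>v\<close> have left the boundary, which makes
      the count sufficient even for k = 0.\<close>
    also have "\<dots> = card D - 2" using u v finite_DF(1) by (subst card_Diff_subset) auto
    finally have c: "card (bd E ({v} \<union> insert u U \<union> \<Union>F) \<inter> X) \<le> card D - 2" .
    have "{u, v} \<subseteq> D" "u \<noteq> v" using u v by auto
    then have D2: "2 \<le> card D" using card_mono[OF finite_DF(1), of "{u, v}"] by simp
    have "chain E X d (?c ({v} \<union> U \<union> \<Union>F)) (?c (insert u ({v} \<union> U \<union> \<Union>F)))"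
    proof (rule absorb_vertex[OF finite_X finite_bd sym])
      show "insert u ({v} \<union> U \<union> \<Union>F) \<subseteq> X" using v u by auto
      show "2 ^ ?s + card (bd E (insert u ({v} \<union> U \<union> \<Union>F)) \<inter> X) \<le> d + 1"
        using c s bag_card D2 by simp
      show "2 ^ ?s \<le> d" using bd_X_card power_increasing[of ?s k "2::nat"] by linarith
    qed
    then show "chain E X d (?c ({v} \<union> U \<union> \<Union>F)) (?c ({v} \<union> insert u U \<union> \<Union>F))"
      by simp
  qed (use finite_DF in auto)
  also have "{v} \<union> (D - {v}) \<union> \<Union>F = X" using v by auto
  finally show ?thesis
    by (simp add: absorbed_empty absorbed_all reducible_def)
qed

end

section \<open>Eliminating the tree\<close>

text \<open>Connectedness expressed by cuts instead of walks. The empty set qualifies, as it must: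
  the set of remaining bags containing a given vertex becomes empty during the elimination.\<close>

definition cut_connected :: "'t rel \<Rightarrow> 't set \<Rightarrow> bool" where
  "cut_connected R W \<longleftrightarrow> (\<forall>U \<subseteq> W. U \<noteq> {} \<longrightarrow> U \<noteq> W \<longrightarrow> (\<exists>x \<in> U. \<exists>y \<in> W - U. (x, y) \<in> R))"

section \<open>Connectedness and leaves in undirected trees\<close>

lemma cut_connectedD:
  assumes "cut_connected R W" "U \<subseteq> W" "U \<noteq> {}" "U \<noteq> W"
  shows "\<exists>x \<in> U. \<exists>y \<in> W - U. (x, y) \<in> R"
  using assms unfolding cut_connected_def by blast

text \<open>If \<open>t\<close> is put on the same side of the cut as its only neighbour
  \<open>p\<close>, the crossing edge cannot be incident with \<open>t\<close>.\<close>

lemma cut_connected_remove_leaf: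
  assumes "cut_connected R W" "sym R" and leaf: "\<And>q. q \<in> W \<Longrightarrow> (t, q) \<in> R \<Longrightarrow> q = p"
  shows "cut_connected R (W - {t})"
  unfolding cut_connected_def
proof (intro allI impI)
  fix U assume U: "U \<subseteq> W - {t}" "U \<noteq> {}" "U \<noteq> W - {t}"
  show "\<exists>x\<in>U. \<exists>y\<in>W - {t} - U. (x, y) \<in> R"
  proof (cases "t \<in> W \<and> p \<in> U")
    case True
    then obtain x y where xy: "x \<in> insert t U" "y \<in> W - insert t U" "(x, y) \<in> R"
      using cut_connectedD[OF assms(1), of "insert t U"] U by auto
    then have "x \<noteq> t" using leaf[of y] True by auto
    then show ?thesis using xy by auto
  next
    case False
    obtain x y where xy: "x \<in> U" "y \<in> W - U" "(x, y) \<in> R"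
      using cut_connectedD[OF assms(1), of U] U False by auto
    moreover have "y \<noteq> t"
    proof
      assume "y = t"
      then have "x = p" using xy U leaf[of x] \<open>sym R\<close> by (auto dest: symD)
      then show False using False \<open>y = t\<close> xy by blast
    qed
    ultimately show ?thesis by auto
  qed
qed

text \<open>A walk from \<open>U\<close> to its complement must leave \<open>U\<close> somewhere.
  The relation ignores orientation because \<open>connected\<close> speaks about the symmetric
  closure.\<close>

lemma connected_imp_cut_connected:
  assumes "connected G"
  shows "cut_connected {(u, v). \<exists>e \<in> arcs G. {tail G e, head G e} = {u, v}} (verts G)"
  unfolding cut_connected_def
proof (intro allI impI)
  let ?R = "{(u, v). \<exists>e \<in> arcs G. {tail G e, head G e} = {u, v}}"
  fix U assume U: "U \<subseteq> verts G" "U \<noteq> {}" "U \<noteq> verts G"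
  then obtain u v where uv: "u \<in> U" "v \<in> verts G" "v \<notin> U" by auto
  have "(u, v) \<in> rtrancl_on (pverts (mk_symmetric G)) (arcs_ends (mk_symmetric G))"
    using assms uv U unfolding connected_def strongly_connected_def reachable_def
    by (auto simp: mk_symmetric_def)
  then have "u \<in> U \<longrightarrow> v \<in> U \<or> (\<exists>x\<in>U. \<exists>y\<in>verts G - U. (x, y) \<in> ?R)"
  proof (induction rule: rtrancl_on_induct)
    case (step y z)
    have "(y, z) \<in> ?R" "z \<in> verts G"
      using step.hyps by (auto simp: mk_symmetric_def arcs_ends_def arc_to_ends_def)
    then show ?case using step.IH by blast
  qed simp
  then show "\<exists>x\<in>U. \<exists>y\<in>verts G - U. (x, y) \<in> ?R" using uv by blast
qed

text \<open>Applied to every nonempty set of nodes of the tree, this is a form of acyclicity that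
  survives the deletion of nodes; the elimination carries it along as \<open>leafy\<close>.\<close>

lemma exists_low_degree_vertex:
  assumes "finite U" "U \<noteq> {}" "irrefl R" "sym R"
    and acyclic: "\<And>xs. distinct xs \<Longrightarrow> 3 \<le> length xs \<Longrightarrow> set xs \<subseteq> U \<Longrightarrow>
      successively (\<lambda>x y. (x, y) \<in> R) xs \<Longrightarrow> (last xs, hd xs) \<notin> R"
  shows "\<exists>t \<in> U. \<forall>p \<in> U. \<forall>q \<in> U. (t, p) \<in> R \<longrightarrow> (t, q) \<in> R \<longrightarrow> p = q"
proof (rule ccontr)
  assume contra: "\<not> ?thesis"
  define path where
    "path xs \<longleftrightarrow> xs \<noteq> [] \<and> distinct xs \<and> set xs \<subseteq> U \<and> successively (\<lambda>x y. (x, y) \<in> R) xs" for xs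
  \<comment> \<open>An end of a longest path has all its neighbours on the path.\<close>
  obtain u where "u \<in> U" using assms(2) by auto
  then have "path [u]" by (simp add: path_def)
  moreover have "length xs < Suc (card U)" if "path xs" for xs
    using that card_mono[OF assms(1), of "set xs"] by (simp add: path_def distinct_card less_Suc_eq_le)
  ultimately obtain xs where xs: "path xs" and longest: "\<And>ys. path ys \<Longrightarrow> length ys \<le> length xs"
    using ex_has_greatest_nat[of path "[u]" length "Suc (card U)"] by blast
  obtain x ys where x: "xs = x # ys" using xs by (cases xs) (auto simp: path_def)
  then obtain p q where pq: "p \<in> U" "q \<in> U" "(x, p) \<in> R" "(x, q) \<in> R" "p \<noteq> q"
    using contra xs by (auto simp: path_def)
  have in_ys: "r \<in> set ys" if "r \<in> U" "(x, r) \<in> R" for r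
  proof (rule ccontr)
    assume "r \<notin> set ys"
    moreover have "r \<noteq> x" using that(2) \<open>irrefl R\<close> by (auto simp: irrefl_def)
    moreover have "(r, x) \<in> R" using that(2) \<open>sym R\<close> by (auto dest: symD)
    ultimately have "path (r # xs)" using xs that x by (simp add: path_def)
    then show False using longest[of "r # xs"] by simp
  qed
  \<comment> \<open>Of the two neighbours of \<open>x\<close> on \<open>ys\<close>, at most one is
    its head. The other, at index i >= 1, closes a cycle with i + 2 >= 3 vertices.\<close>
  obtain i r where i: "i < length ys" "ys ! i = r" "1 \<le> i" "(x, r) \<in> R"
  proof -
    obtain i j where ij: "i < length ys" "ys ! i = p" "j < length ys" "ys ! j = q"
      using in_ys pq by (metis in_set_conv_nth)
    then have "i \<noteq> j" using pq by auto
    then show thesis using that[of i p] that[of j q] ij pq by force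
  qed
  let ?zs = "take (i + 2) xs"
  have "path ?zs"
  proof -
    have "successively (\<lambda>x y. (x, y) \<in> R) (?zs @ drop (i + 2) xs)"
      using xs by (simp add: path_def)
    then have "successively (\<lambda>x y. (x, y) \<in> R) ?zs" by (simp only: successively_append_iff)
    then show ?thesis using xs set_take_subset[of "i + 2" xs] by (auto simp: path_def)
  qed
  moreover have "3 \<le> length ?zs" using i x by simp
  moreover have "last ?zs = r"
  proof -
    have "?zs \<noteq> []" "length ?zs = i + 2" using i x by simp_all
    then have "last ?zs = xs ! (i + 1)" by (simp add: last_conv_nth)
    then show ?thesis using i x by simp
  qed
  moreover have "hd ?zs = x" using x by simp
  ultimately have "(r, x) \<notin> R" using acyclic[of ?zs] by (simp add: path_def)
  then show False using i(4) \<open>sym R\<close> by (auto dest: symD)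
qed

text \<open>Walks are lists of arcs, and the arcs of \<open>with_proj T\<close> are pairs, so
  zipping a vertex list with its shift gives the walk. It is closed to a cycle by taking
  \<open>hd xs\<close> for \<open>v\<close>.\<close>

lemma awalk_of_path:
  assumes "xs \<noteq> []" "successively (\<lambda>x y. (x, y) \<in> parcs T) xs" "(last xs, v) \<in> parcs T"
  shows "pre_digraph.cas (with_proj T) (hd xs) (zip xs (tl xs @ [v])) v \<and>
    pre_digraph.awalk_verts (with_proj T) (hd xs) (zip xs (tl xs @ [v])) = xs @ [v] \<and>
    set (zip xs (tl xs @ [v])) \<subseteq> parcs T"
  using assms
proof (induction xs rule: induct_list012)
  case (3 x y zs)
  then show ?case
    by (simp add: pre_digraph.cas.simps pre_digraph.awalk_verts.simps)
qed (simp_all add: pre_digraph.cas.simps pre_digraph.awalk_verts.simps)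

lemma undirected_treeD:
  assumes "undirected_tree (with_proj T)"
  shows "finite (pverts T)" "pverts T \<noteq> {}" "sym (parcs T)" "irrefl (parcs T)"
    "cut_connected (parcs T) (pverts T)"
    "\<And>xs. distinct xs \<Longrightarrow> 3 \<le> length xs \<Longrightarrow> set xs \<subseteq> pverts T \<Longrightarrow>
       successively (\<lambda>x y. (x, y) \<in> parcs T) xs \<Longrightarrow> (last xs, hd xs) \<notin> parcs T"
proof -
  interpret graph "with_proj T" using assms by (simp add: undirected_tree_def)
  have conn: "connected (with_proj T)" using assms by (simp add: undirected_tree_def)
  show "finite (pverts T)" using finite_verts by simp
  show "pverts T \<noteq> {}"
    using conn by (auto simp: connected_def strongly_connected_def mk_symmetric_def)
  show s: "sym (parcs T)"
    using sym_arcs by (simp add: symmetric_def arcs_ends_def arc_to_ends_def)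
  show "irrefl (parcs T)" using no_loops by (fastforce simp: irrefl_def)
  have "{(u, v). \<exists>e\<in>parcs T. {fst e, snd e} = {u, v}} = parcs T"
    using s by (force simp: doubleton_eq_iff dest: symD)
  then show "cut_connected (parcs T) (pverts T)"
    using connected_imp_cut_connected[OF conn] by simp
  fix xs assume xs: "distinct xs" "3 \<le> length xs" "set xs \<subseteq> pverts T"
    "successively (\<lambda>x y. (x, y) \<in> parcs T) xs"
  show "(last xs, hd xs) \<notin> parcs T"
  proof
    assume last: "(last xs, hd xs) \<in> parcs T"
    have "xs \<noteq> []" using xs(2) by auto
    note walk = awalk_of_path[OF this xs(4) last]
    let ?p = "zip xs (tl xs @ [hd xs])"
    have "distinct (tl (xs @ [hd xs]))" using xs(1) \<open>xs \<noteq> []\<close> by (cases xs) auto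
    moreover have "hd xs \<in> pverts T" using \<open>xs \<noteq> []\<close> xs(3) by (cases xs) auto
    moreover have "length ?p = length xs" using xs(2) by simp
    ultimately have "cycle ?p" "3 \<le> length ?p"
      unfolding cycle_def awalk_def using walk xs(2) by auto
    then show False using assms by (auto simp: undirected_tree_def)
  qed
qed

lemma cut_connected_restrict:
  assumes "undirected_tree (with_proj T \<restriction> W)" "sym (parcs T)"
  shows "cut_connected (parcs T) W"
proof -
  have "cut_connected {(u, v). \<exists>e\<in>{e \<in> parcs T. fst e \<in> W \<and> snd e \<in> W}. {fst e, snd e} = {u, v}} W"
    using connected_imp_cut_connected[of "with_proj T \<restriction> W"] assms(1)
    by (simp add: undirected_tree_def induce_subgraph_def)
  moreover have "{(u, v). \<exists>e\<in>{e \<in> parcs T. fst e \<in> W \<and> snd e \<in> W}. {fst e, snd e} = {u, v}} \<subseteq> parcs T"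
    using assms(2) by (auto simp: doubleton_eq_iff dest: symD)
  ultimately show ?thesis unfolding cut_connected_def by blast
qed

section \<open>Bottom-up elimination of the bags\<close>

text \<open>
  The state of the bottom-up elimination of the tree: \<open>W\<close> are the remaining nodes of the tree with
  edges \<open>R\<close>, and \<open>F\<close> consists of the already reducible parts hanging below the remaining bags.
\<close>

locale elimination =
  fixes E :: "'a rel" and V :: "'a set" and k b :: nat
    and R :: "'t rel" and B :: "'t \<Rightarrow> 'a set" and W :: "'t set" and F :: "'a set set"
  assumes finite_E: "finite E" and sym_E: "sym E" and E_sub: "E \<subseteq> V \<times> V"
    and sym_R: "sym R" and finite_W: "finite W" and W_nonempty: "W \<noteq> {}"
    and leafy: "\<And>U. U \<subseteq> W \<Longrightarrow> U \<noteq> {} \<Longrightarrow>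
      \<exists>t \<in> U. \<forall>p \<in> U. \<forall>q \<in> U. (t, p) \<in> R \<longrightarrow> (t, q) \<in> R \<longrightarrow> p = q"
    and conn: "cut_connected R W" and conn_bags: "\<And>v. cut_connected R {t \<in> W. v \<in> B t}"
    and finite_B: "\<And>t. t \<in> W \<Longrightarrow> finite (B t)" and card_B: "\<And>t. t \<in> W \<Longrightarrow> card (B t) \<le> b"
    and adhesion: "\<And>s t. s \<in> W \<Longrightarrow> t \<in> W \<Longrightarrow> (s, t) \<in> R \<Longrightarrow> card (B s \<inter> B t) \<le> k"
    and finite_F: "finite F" "\<And>Y. Y \<in> F \<Longrightarrow> finite Y"
    and disj: "\<And>Y Z. Y \<in> F \<Longrightarrow> Z \<in> F \<Longrightarrow> Y \<noteq> Z \<Longrightarrow> Y \<inter> Z = {}"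
    and disj_B: "\<And>Y t. Y \<in> F \<Longrightarrow> t \<in> W \<Longrightarrow> Y \<inter> B t = {}"
    and bd_F: "\<And>Y. Y \<in> F \<Longrightarrow> \<exists>t \<in> W. bd E Y \<subseteq> B t"
    and bd_card: "\<And>Y. Y \<in> F \<Longrightarrow> card (bd E Y) \<le> k"
    and red_F: "\<And>Y. Y \<in> F \<Longrightarrow> reducible E (2 ^ k + 2 ^ k div 2 + (b - (k + 3))) Y"
    and cover: "V = \<Union>F \<union> \<Union>(B ` W)"
    and edges: "\<And>u v s t. (u, v) \<in> E \<Longrightarrow> s \<in> W \<Longrightarrow> u \<in> B s \<Longrightarrow> t \<in> W \<Longrightarrow> v \<in> B t \<Longrightarrow>
      \<exists>r \<in> W. u \<in> B r \<and> v \<in> B r"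
begin

text \<open>Meant for the private vertices \<open>D\<close> of a bag. Once they disappear with the
  bag, the boundary of such a part fits into no remaining bag, so the part has to be treated
  now.\<close>

definition attached :: "'a set \<Rightarrow> 'a set set" where
  "attached D = {Y \<in> F. bd E Y \<inter> D \<noteq> {}}"

definition region :: "'a set \<Rightarrow> 'a set" where
  "region D = D \<union> \<Union>(attached D)"

end

text \<open>\<open>N\<close> is the bag of the only remaining neighbour of \<open>t\<close>, or
  empty when \<open>t\<close> is the last node. Leaf and root are thereby handled alike.\<close>

locale elimination_step = elimination +
  fixes t N
  assumes t: "t \<in> W" and N: "card (B t \<inter> N) \<le> k"
    and priv: "\<And>v s. v \<in> B t \<Longrightarrow> s \<in> W \<Longrightarrow> s \<noteq> t \<Longrightarrow> v \<in> B s \<Longrightarrow> v \<in> N"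
begin

abbreviation (input) "D \<equiv> B t - N"

lemma only_bag: "v \<in> D \<Longrightarrow> s \<in> W \<Longrightarrow> v \<in> B s \<Longrightarrow> s = t"
  using priv by blast

lemma attached_bd: "Y \<in> attached D \<Longrightarrow> Y \<in> F \<and> bd E Y \<subseteq> B t"
  using bd_F[of Y] only_bag unfolding attached_def by blast

text \<open>A neighbour of a vertex of \<open>D\<close> lies in an attached part or shares a bag
  with it, and that bag can only be \<open>B t\<close>. An attached part has its whole boundary in
  one bag, again \<open>B t\<close> because the boundary meets \<open>D\<close>.\<close>

lemma bd_region: "bd E (region D) \<subseteq> B t \<inter> N"
proof
  fix v assume "v \<in> bd E (region D)"
  then obtain a where a: "(a, v) \<in> E" "a \<in> region D" "v \<notin> region D" by (auto simp: bd_def)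
  have "v \<in> B t"
  proof (cases "a \<in> D")
    case True
    have "v \<in> V" using a(1) E_sub by auto
    moreover have "v \<notin> Z" if "Z \<in> F" for Z
    proof
      assume "v \<in> Z"
      have "a \<notin> Z" using True disj_B[OF that t] by blast
      then have "a \<in> bd E Z" using a(1) \<open>v \<in> Z\<close> sym_E unfolding bd_def by (auto dest: symD)
      then have "Z \<in> attached D" using True that unfolding attached_def by blast
      then show False using \<open>v \<in> Z\<close> a(3) unfolding region_def by blast
    qed
    ultimately obtain s where "s \<in> W" "v \<in> B s" using cover by blast
    then obtain r where "r \<in> W" "a \<in> B r" "v \<in> B r" using edges[OF a(1) t] True by blast
    then show ?thesis using only_bag[OF True] by blast
  next
    case False
    then obtain Y where Y: "Y \<in> attached D" "a \<in> Y" using a(2) by (auto simp: region_def)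
    then have "v \<in> bd E Y" using a by (auto simp: bd_def region_def)
    then show ?thesis using attached_bd[OF Y(1)] by blast
  qed
  then show "v \<in> B t \<inter> N" using a(3) unfolding region_def by blast
qed

lemma card_bd_region: "card (bd E (region D)) \<le> card (B t \<inter> N)"
  using bd_region finite_B[OF t] by (intro card_mono) auto

lemma reducible_attached: "reducible E (2 ^ k + 2 ^ k div 2 + (b - (k + 3))) (region D)"
proof -
  have F: "Y \<in> F" if "Y \<in> attached D" for Y using that by (simp add: attached_def)
  interpret bag_region E D "attached D" k b
  proof
    show "finite (attached D)" using finite_F by (simp add: attached_def)
    show "Y \<inter> D = {}" if "Y \<in> attached D" for Y using disj_B[OF F[OF that] t] by blast
    show "bd E Y \<inter> Z = {}" if "Y \<in> attached D" "Z \<in> attached D" for Y Z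
      using attached_bd[OF that(1)] disj_B[OF F[OF that(2)] t] by blast
    show "bd E Y \<inter> D \<noteq> {}" if "Y \<in> attached D" for Y using that by (simp add: attached_def)
    show "card (bd E (D \<union> \<Union>(attached D))) \<le> k"
      using card_bd_region N by (simp add: region_def)
    have "card (B t) = card (B t \<inter> N) + card D"
      using finite_B[OF t] by (intro card_Int_Diff)
    then show "card D + card (bd E (D \<union> \<Union>(attached D))) \<le> b"
      using card_bd_region card_B[OF t] by (simp add: region_def)
  qed (use finite_E sym_E finite_B[OF t] finite_F disj bd_card red_F F in blast)+
  show ?thesis unfolding region_def by (rule reducible_region)
qed

lemma new_disj:
  assumes "Y \<in> insert (region D) (F - attached D)" "Z \<in> insert (region D) (F - attached D)" "Y \<noteq> Z"
  shows "Y \<inter> Z = {}"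
proof -
  have *: "region D \<inter> Z = {}" if "Z \<in> F" "Z \<notin> attached D" for Z
  proof -
    have "Y \<inter> Z = {}" if "Y \<in> attached D" for Y
      using that \<open>Z \<in> F\<close> \<open>Z \<notin> attached D\<close> disj[of Y Z] unfolding attached_def by blast
    then show ?thesis using disj_B[OF that(1) t] unfolding region_def by blast
  qed
  then show ?thesis using assms disj by blast
qed

lemma new_cover:
  assumes "N \<subseteq> \<Union>(B ` (W - {t}))"
  shows "V = \<Union>(insert (region D) (F - attached D)) \<union> \<Union>(B ` (W - {t}))"
proof -
  have "\<Union>(attached D) \<subseteq> \<Union>F" by (auto simp: attached_def)
  moreover have "\<Union>F = \<Union>(attached D) \<union> \<Union>(F - attached D)" by (auto simp: attached_def)
  moreover have "\<Union>(B ` W) = D \<union> (B t \<inter> N) \<union> \<Union>(B ` (W - {t}))" using t by auto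
  ultimately show ?thesis using cover assms unfolding region_def by auto
qed

text \<open>A boundary inside \<open>B t\<close> that avoids \<open>D\<close> lies in
  \<open>N\<close>, so the part can be handed over to the neighbouring bag.\<close>

lemma unattached_bd:
  assumes "Y \<in> F - attached D"
  shows "bd E Y \<subseteq> B t \<inter> N \<or> (\<exists>s \<in> W - {t}. bd E Y \<subseteq> B s)"
  using bd_F[of Y] assms unfolding attached_def by blast

lemma finite_region: "finite (region D)"
  using finite_B[OF t] finite_F by (auto simp: region_def attached_def)

end

text \<open>The result is a family, not a single part: a part with empty boundary is never attached
  to a bag, so several may survive when the graph is disconnected.\<close>

lemma elimination_complete:
  assumes "elimination E V k b R B W F"
  shows "\<exists>F'. finite F' \<and> (\<forall>Y \<in> F'. finite Y \<and> bd E Y = {} \<and>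
      reducible E (2 ^ k + 2 ^ k div 2 + (b - (k + 3))) Y) \<and>
    (\<forall>Y \<in> F'. \<forall>Z \<in> F'. Y \<noteq> Z \<longrightarrow> Y \<inter> Z = {}) \<and> V = \<Union>F'"
  using assms
proof (induction "card W" arbitrary: W F rule: less_induct)
  case less
  interpret elimination E V k b R B W F by (rule less.prems)
  obtain t where t: "t \<in> W" and deg: "\<And>p q. p \<in> W \<Longrightarrow> q \<in> W \<Longrightarrow> (t, p) \<in> R \<Longrightarrow> (t, q) \<in> R \<Longrightarrow> p = q"
    using leafy[OF subset_refl W_nonempty] by blast
  show ?case
  proof (cases "W = {t}")
    case True
    interpret elimination_step E V k b R B W F t "{}"
      using True by unfold_locales auto
    let ?D = "B t - {}"
    let ?F = "insert (region ?D) (F - attached ?D)"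
    have "bd E (region ?D) = {}" using bd_region by blast
    moreover have "bd E Y = {}" if "Y \<in> F - attached ?D" for Y
      using unattached_bd[OF that] True by blast
    moreover have "V = \<Union>?F" using new_cover True by simp
    moreover have "\<forall>Y \<in> ?F. \<forall>Z \<in> ?F. Y \<noteq> Z \<longrightarrow> Y \<inter> Z = {}" using new_disj by blast
    moreover have "finite ?F" using finite_F by simp
    moreover note finite_region reducible_attached finite_F(2) red_F
    ultimately show ?thesis by (intro exI[of _ ?F]) blast
  next
    case False
    then obtain p where p: "p \<in> W" "p \<noteq> t" "(t, p) \<in> R"
      using cut_connectedD[OF conn, of "{t}"] t by blast
    have leaf: "q = p" if "q \<in> W" "(t, q) \<in> R" for q using deg[OF that(1) p(1) that(2) p(3)] .
    have N: "card (B t \<inter> B p) \<le> k" using adhesion[OF t p(1,3)] .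
    \<comment> \<open>If \<open>v\<close> also lies in another remaining bag, connectedness of the
      nodes whose bags contain \<open>v\<close> gives an edge from \<open>t\<close> to one of them,
      and \<open>p\<close> is the only neighbour of \<open>t\<close>.\<close>
    have priv: "v \<in> B p" if v: "v \<in> B t" "s \<in> W" "s \<noteq> t" "v \<in> B s" for v s
    proof -
      obtain y where "y \<in> W" "v \<in> B y" "(t, y) \<in> R"
        using cut_connectedD[OF conn_bags[of v], of "{t}"] t v by blast
      then show ?thesis using leaf by blast
    qed
    interpret elimination_step E V k b R B W F t "B p"
      using t N priv by unfold_locales
    let ?D = "B t - B p"
    let ?F = "insert (region ?D) (F - attached ?D)"
    have bd_X: "bd E (region ?D) \<subseteq> B t \<inter> B p" by (rule bd_region)
    have disj_X: "region ?D \<inter> B s = {}" if "s \<in> W - {t}" for s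
    proof -
      have "?D \<inter> B s = {}" using priv that by blast
      moreover have "\<Union>(attached ?D) \<inter> B s = {}"
        using disj_B that unfolding attached_def by blast
      ultimately show ?thesis unfolding region_def by blast
    qed
    have "elimination E V k b R B (W - {t}) ?F"
    proof
      show "W - {t} \<noteq> {}" using p by blast
      show "cut_connected R (W - {t})" using cut_connected_remove_leaf[OF conn sym_R leaf] .
      show "cut_connected R {s \<in> W - {t}. v \<in> B s}" for v
      proof -
        have "cut_connected R ({s \<in> W. v \<in> B s} - {t})"
          using leaf by (intro cut_connected_remove_leaf[OF conn_bags sym_R]) blast
        moreover have "{s \<in> W. v \<in> B s} - {t} = {s \<in> W - {t}. v \<in> B s}" by blast
        ultimately show ?thesis by simp
      qed
      show "\<exists>s\<in>W - {t}. bd E Y \<subseteq> B s" if "Y \<in> ?F" for Y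
      proof (cases "Y = region ?D")
        case True then show ?thesis using bd_X p by blast
      next
        case False
        then show ?thesis using that unattached_bd[of Y] p by blast
      qed
      show "card (bd E Y) \<le> k" if "Y \<in> ?F" for Y
        using that bd_card card_bd_region N by fastforce
      show "reducible E (2 ^ k + 2 ^ k div 2 + (b - (k + 3))) Y" if "Y \<in> ?F" for Y
        using that red_F reducible_attached by blast
      show "V = \<Union>?F \<union> \<Union>(B ` (W - {t}))"
        using p by (intro new_cover) auto
      show "\<exists>r\<in>W - {t}. u \<in> B r \<and> v \<in> B r"
 if uv: "(u, v) \<in> E" "s \<in> W - {t}" "u \<in> B s" "s' \<in> W - {t}" "v \<in> B s'" for u v s s'
      proof -
        obtain r where "r \<in> W" "u \<in> B r" "v \<in> B r" using edges[OF uv(1)] uv by blast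
        then show ?thesis using priv uv p by blast
      qed
      show "Y \<inter> Z = {}" if "Y \<in> ?F" "Z \<in> ?F" "Y \<noteq> Z" for Y Z
        using new_disj[OF that] .
      show "Y \<inter> B s = {}" if "Y \<in> ?F" "s \<in> W - {t}" for Y s
        using that disj_X disj_B by blast
      show "finite Y" if "Y \<in> ?F" for Y using that finite_F finite_region by blast
      show "\<exists>t'\<in>U. \<forall>p\<in>U. \<forall>q\<in>U. (t', p) \<in> R \<longrightarrow> (t', q) \<in> R \<longrightarrow> p = q"
        if "U \<subseteq> W - {t}" "U \<noteq> {}" for U
        using that by (intro leafy) auto
      show "finite ?F" using finite_F by simp
    qed (use finite_E sym_E E_sub sym_R finite_W finite_B card_B adhesion in auto)
    moreover have "card (W - {t}) < card W" using t finite_W by (rule card_Diff1_less[rotated])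
    ultimately show ?thesis by (rule less.hyps[rotated])
  qed
qed

text \<open>With empty boundaries only one class of each kind arises and nothing is red between two
  parts. The condition 1 <= d is the instance 1 + 1 + 0 <= d + 1 of \<open>mid_le\<close>.\<close>

lemma chain_components:
  assumes "finite E" "sym E" "finite F" "1 \<le> d"
    and F: "\<And>Y. Y \<in> F \<Longrightarrow> finite Y" "\<And>Y. Y \<in> F \<Longrightarrow> bd E Y = {}" "\<And>Y. Y \<in> F \<Longrightarrow> reducible E d Y"
    and disj: "\<And>Y Z. Y \<in> F \<Longrightarrow> Z \<in> F \<Longrightarrow> Y \<noteq> Z \<Longrightarrow> Y \<inter> Z = {}"
    and E_sub: "E \<subseteq> \<Union>F \<times> \<Union>F" and "\<Union>F \<noteq> {}"
  shows "chain E (\<Union>F) d (classes id (\<Union>F)) {\<Union>F}"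
proof -
  let ?V = "\<Union>F"
  have "chain E ?V d (classes (absorbed E ?V (\<Union>{})) ?V) (classes (absorbed E ?V (\<Union>F)) ?V)"
  proof (rule chain_finite_induct)
    fix U Y assume U: "insert Y U \<subseteq> F" "Y \<notin> U"
    have bdU: "bd E (\<Union>G) = {}" if "G \<subseteq> F" for G
      using F(2) that unfolding bd_def by blast
    have YU: "\<Union>U \<inter> Y = {}" using U disj by blast
    interpret absorb_region E ?V "\<Union>U" Y d
    proof
      have "bd E ?V = {}" "bd E Y = {}" "bd E (\<Union>U \<union> Y) = {}"
        using bdU[of F] bdU[of "{Y}"] bdU[of "insert Y U"] U by (auto simp: Un_commute)
      then show "finite (bd E ?V)" "finite (bd E Y)"
        "2 ^ card (bd E ?V) + 2 ^ card (bd E Y - ?V) + card (bd E (\<Union>U \<union> Y) \<inter> ?V) \<le> d + 2"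
        "bd E (\<Union>U \<union> Y) \<inter> ?V \<noteq> {} \<Longrightarrow> 2 ^ card (bd E ?V) + 2 ^ card (bd E Y - ?V) \<le> d"
        "2 ^ card (bd E ?V) + 2 ^ card (bd E Y - ?V) + card (bd E Y \<inter> ?V) \<le> d + 1"
        "2 ^ card (bd E Y) + card (bd E Y \<inter> ?V) \<le> d + 1"
        using \<open>1 \<le> d\<close> by simp_all
      show "\<Union>U \<times> Y \<inter> E = {}" using bdU[of U] U YU unfolding bd_def by blast
    qed (use assms U YU in auto)
    have "\<Union>(insert Y U) = \<Union>U \<union> Y" by blast
    then show "chain E ?V d (classes (absorbed E ?V (\<Union>U)) ?V)
        (classes (absorbed E ?V (\<Union>(insert Y U))) ?V)"
      using chain_absorb by simp
  qed (rule assms(3))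
  moreover have "classes (absorbed E ?V ?V) ?V = {?V}"
    using E_sub \<open>?V \<noteq> {}\<close> unfolding absorbed_all
    by (subst classes_cong[where c' = "\<lambda>_. ()"]) (auto simp: classes_def)
  ultimately show ?thesis using absorbed_empty[of E ?V] by simp
qed

section \<open>From partition sequences to contraction sequences\<close>

text \<open>Contraction sequences stay within the vertex type of the graph, so a part must be named
  by a vertex. Naming it by one of its own elements makes the names distinct.\<close>

definition quotient_trigraph :: "'a rel \<Rightarrow> 'a set set \<Rightarrow> ('a set \<Rightarrow> 'a) \<Rightarrow> 'a trigraph" where
  "quotient_trigraph E P f = \<lparr>tverts = f ` P,
     black = {(f A, f B) | A B. A \<in> P \<and> B \<in> P \<and> A \<noteq> B \<and> A \<times> B \<subseteq> E},
     red = {(f A, f B) | A B. A \<in> P \<and> B \<in> P \<and> A \<noteq> B \<and> mixed E A B}\<rparr>"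

definition choice_on :: "'a set set \<Rightarrow> ('a set \<Rightarrow> 'a) \<Rightarrow> bool" where
  "choice_on P f \<longleftrightarrow> (\<forall>A \<in> P. f A \<in> A)"

lemma choice_inj_on:
  assumes "partition_on V P" "choice_on P f"
  shows "inj_on f P"
proof (rule inj_onI)
  fix A B assume "A \<in> P" "B \<in> P" "f A = f B"
  then have "f A \<in> A \<inter> B" using assms(2) by (metis IntI choice_on_def)
  then show "A = B" using partition_onD2[OF assms(1)] \<open>A \<in> P\<close> \<open>B \<in> P\<close> by (auto dest: disjointD)
qed

lemma red_degree_quotient:
  assumes "partition_on V P" "choice_on P f" "A \<in> P"
  shows "red_degree (quotient_trigraph E P f) (f A) = red_deg E P A"
proof -
  have inj: "inj_on f P" using choice_inj_on[OF assms(1,2)] .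
  have "{u. (f A, u) \<in> red (quotient_trigraph E P f)} = f ` {B \<in> P. B \<noteq> A \<and> mixed E A B}"
  proof (intro subset_antisym subsetI)
    fix u assume "u \<in> {u. (f A, u) \<in> red (quotient_trigraph E P f)}"
    then obtain A' B where "f A = f A'" "u = f B" "A' \<in> P" "B \<in> P" "A' \<noteq> B" "mixed E A' B"
      by (auto simp: quotient_trigraph_def)
    then show "u \<in> f ` {B \<in> P. B \<noteq> A \<and> mixed E A B}"
      using inj_onD[OF inj, of A A'] assms(3) by blast
  qed (use assms(3) in \<open>auto simp: quotient_trigraph_def\<close>)
  then show ?thesis
    unfolding red_degree_def red_deg_def
    by (simp add: card_image inj_on_subset[OF inj])
qed

lemma classes_id: "classes id V = (\<lambda>v. {v}) ` V"
  unfolding classes_def by (intro image_cong) auto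

lemma quotient_singletons:
  assumes "pair_graph G"
  shows "quotient_trigraph (parcs G) (classes id (pverts G)) the_elem = trigraph_of G"
proof -
  interpret pair_graph G by (rule assms)
  note P = classes_id[of "pverts G"]
  have "parcs G \<subseteq> pverts G \<times> pverts G" using arc_fst_in_verts arc_snd_in_verts by fastforce
  moreover have "(u, u) \<notin> parcs G" for u using pair_no_loops by fastforce
  ultimately have arc: "u \<in> pverts G \<and> v \<in> pverts G \<and> u \<noteq> v" if "(u, v) \<in> parcs G" for u v
    using that by blast
  have "{(the_elem A, the_elem B) | A B. A \<in> (\<lambda>v. {v}) ` pverts G \<and>
      B \<in> (\<lambda>v. {v}) ` pverts G \<and> A \<noteq> B \<and> A \<times> B \<subseteq> parcs G} = parcs G" (is "?L = _")
  proof (intro subset_antisym subsetI)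
    fix e assume "e \<in> parcs G"
    then obtain u v where e: "e = (u, v)" "(u, v) \<in> parcs G" by (cases e) auto
    then show "e \<in> ?L"
      using arc[OF e(2)] by (intro CollectI exI[of _ "{u}"] exI[of _ "{v}"]) auto
  qed auto
  moreover have "{(the_elem A, the_elem B) | A B. A \<in> (\<lambda>v. {v}) ` pverts G \<and>
      B \<in> (\<lambda>v. {v}) ` pverts G \<and> A \<noteq> B \<and> mixed (parcs G) A B} = {}"
    by (auto simp: mixed_def)
  moreover have "the_elem ` (\<lambda>v. {v}) ` pverts G = pverts G" by (simp add: image_image)
  ultimately show ?thesis unfolding quotient_trigraph_def trigraph_of_def P by simp
qed

text \<open>The union inherits the name of \<open>A\<close>, one of the two names that a contraction
  may reuse. It is adjacent to a part as soon as one edge runs there and black exactly when both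
  halves are black, so the remaining adjacencies are the mixed ones.\<close>

lemma contract_quotient:
  assumes P: "partition_on V P" and f: "choice_on P f" and "sym E"
    and AB: "A \<in> P" "B \<in> P" "A \<noteq> B"
  shows "quotient_trigraph E (insert (A \<union> B) (P - {A, B})) (f(A \<union> B := f A)) =
    contract (quotient_trigraph E P f) (f A) (f B) (f A)"
proof -
  define Q where "Q = P - {A, B}"
  define M where "M = A \<union> B"
  let ?z = "f A" and ?H = "quotient_trigraph E P f" and ?f = "f(M := f A)"
  have inj: "inj_on f P" using choice_inj_on[OF P f] .
  have nonempty: "C \<noteq> {}" if "C \<in> P" for C using partition_onD3[OF P] that by auto
  \<comment> \<open>The union is not an old part, so updating \<open>f\<close> there changes no
    other name.\<close>
  have M: "M \<notin> P"
  proof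
    assume "M \<in> P"
    then have "M = A \<or> M \<inter> A = {}" "M = B \<or> M \<inter> B = {}"
      using partition_onD2[OF P] AB by (auto simp: disjoint_def)
    then have "M = A" "M = B" using nonempty[OF AB(1)] nonempty[OF AB(2)] by (auto simp: M_def)
    then show False using AB(3) by simp
  qed
  have f': "?f C = f C" if "C \<in> Q" for C using that M by (auto simp: Q_def)
  have fM: "?f M = f A" by simp
  have QP: "Q \<subseteq> P" "A \<notin> Q" "B \<notin> Q" "M \<notin> Q" using M by (auto simp: Q_def)
  have verts: "tverts ?H - {f A, f B} = f ` Q"
    using inj AB by (auto simp: quotient_trigraph_def Q_def dest: inj_onD)
  have symE: "C \<times> D \<subseteq> E \<longleftrightarrow> D \<times> C \<subseteq> E" "C \<times> D \<inter> E = {} \<longleftrightarrow> D \<times> C \<inter> E = {}" for C D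
    using \<open>sym E\<close> by (auto dest: symD)
  have mixed_sym: "mixed E C D \<longleftrightarrow> mixed E D C" for C D
    using symE[of C D] by (simp add: mixed_def)
  have blackH: "(f C, f D) \<in> black ?H \<longleftrightarrow> C \<noteq> D \<and> C \<times> D \<subseteq> E" if "C \<in> P" "D \<in> P" for C D
    using that inj by (auto simp: quotient_trigraph_def dest: inj_onD)
  have redH: "(f C, f D) \<in> red ?H \<longleftrightarrow> C \<noteq> D \<and> mixed E C D" if "C \<in> P" "D \<in> P" for C D
  proof
    assume "(f C, f D) \<in> red ?H"
    then obtain C' D' where "f C = f C'" "f D = f D'" "C' \<in> P" "D' \<in> P" "C' \<noteq> D'" "mixed E C' D'"
      by (auto simp: quotient_trigraph_def)
    then show "C \<noteq> D \<and> mixed E C D"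
      using inj_onD[OF inj, of C C'] inj_onD[OF inj, of D D'] that by simp
  qed (use that in \<open>auto simp: quotient_trigraph_def\<close>)
  have common: "common_black ?H (f A) (f B) = f ` {C \<in> Q. M \<times> C \<subseteq> E}"
  proof -
    have "common_black ?H (f A) (f B) =
        {u \<in> f ` Q. (f A, u) \<in> black ?H \<and> (f B, u) \<in> black ?H}"
      unfolding common_black_def verts ..
    also have "\<dots> = f ` {C \<in> Q. (f A, f C) \<in> black ?H \<and> (f B, f C) \<in> black ?H}" by auto
    also have "{C \<in> Q. (f A, f C) \<in> black ?H \<and> (f B, f C) \<in> black ?H} = {C \<in> Q. M \<times> C \<subseteq> E}"
    proof (intro Collect_cong conj_cong refl)
      fix C assume "C \<in> Q"
      then have "C \<in> P" "A \<noteq> C" "B \<noteq> C" using QP by auto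
      then show "((f A, f C) \<in> black ?H \<and> (f B, f C) \<in> black ?H) = (M \<times> C \<subseteq> E)"
        using blackH AB unfolding M_def by auto
    qed
    finally show ?thesis .
  qed
  have other: "other_nbrs ?H (f A) (f B) = f ` {C \<in> Q. mixed E M C}"
  proof -
    have "other_nbrs ?H (f A) (f B) = {u \<in> f ` Q. (f A, u) \<in> black ?H \<union> red ?H \<or>
        (f B, u) \<in> black ?H \<union> red ?H} - f ` {C \<in> Q. M \<times> C \<subseteq> E}"
      unfolding other_nbrs_def verts common ..
    also have "\<dots> = f ` {C \<in> Q. ((f A, f C) \<in> black ?H \<union> red ?H \<or>
        (f B, f C) \<in> black ?H \<union> red ?H) \<and> \<not> M \<times> C \<subseteq> E}"
      using inj_onD[OF inj] QP(1) by blast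
    also have "{C \<in> Q. ((f A, f C) \<in> black ?H \<union> red ?H \<or>
        (f B, f C) \<in> black ?H \<union> red ?H) \<and> \<not> M \<times> C \<subseteq> E} = {C \<in> Q. mixed E M C}"
    proof (intro Collect_cong conj_cong refl)
      fix C assume "C \<in> Q"
      then have C: "C \<in> P" "A \<noteq> C" "B \<noteq> C" using QP by auto
      have adj: "(f A', f C) \<in> black ?H \<union> red ?H \<longleftrightarrow> A' \<times> C \<inter> E \<noteq> {}"
        if "A' \<in> P" "A' \<noteq> C" for A'
        using blackH[OF that(1) C(1)] redH[OF that(1) C(1)] that nonempty[OF that(1)] nonempty[OF C(1)]
        unfolding mixed_def by blast
      have "(M \<times> C \<inter> E \<noteq> {}) \<longleftrightarrow> (A \<times> C \<inter> E \<noteq> {} \<or> B \<times> C \<inter> E \<noteq> {})"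
        unfolding M_def by blast
      then show "(((f A, f C) \<in> black ?H \<union> red ?H \<or> (f B, f C) \<in> black ?H \<union> red ?H) \<and>
          \<not> M \<times> C \<subseteq> E) = mixed E M C"
        using adj[OF AB(1) C(2)] adj[OF AB(2) C(3)] unfolding mixed_def by blast
    qed
    finally show ?thesis .
  qed
  \<comment> \<open>Black and red edges are both given by a symmetric predicate on pairs of distinct
    parts, so one computation serves for the two relations.\<close>
  have split: "{(?f C, ?f D) | C D. C \<in> insert M Q \<and> D \<in> insert M Q \<and> C \<noteq> D \<and> p C D} =
      {(u, v) \<in> {(f C, f D) | C D. C \<in> P \<and> D \<in> P \<and> C \<noteq> D \<and> p C D}. {u, v} \<inter> {f A, f B} = {}}
        \<union> {?z} \<times> f ` {C \<in> Q. p M C} \<union> f ` {C \<in> Q. p M C} \<times> {?z}"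
    (is "?L = ?R1 \<union> ?R2 \<union> ?R3") if p: "\<And>C D. p C D \<longleftrightarrow> p D C" for p
  proof -
    have "?L = {(f C, f D) | C D. C \<in> Q \<and> D \<in> Q \<and> C \<noteq> D \<and> p C D} \<union> ?R2 \<union> ?R3"
      (is "_ = ?R0 \<union> _ \<union> _")
    proof (intro subset_antisym subsetI)
      fix x assume "x \<in> ?L"
      then obtain C D where CD: "x = (?f C, ?f D)" "C \<in> insert M Q" "D \<in> insert M Q" "C \<noteq> D" "p C D"
        by blast
      then consider "C \<in> Q" "D \<in> Q" | "C = M" "D \<in> Q" | "C \<in> Q" "D = M" by blast
      then show "x \<in> ?R0 \<union> ?R2 \<union> ?R3"
      proof cases
        case 1
        then show ?thesis using CD(1,4,5) f' by auto
      next
        case 2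
        then show ?thesis using CD(1,5) f'[OF 2(2)] by auto
      next
        case 3
        then show ?thesis using CD(1,5) f'[OF 3(1)] p[of C D] by auto
      qed
    next
      fix x assume "x \<in> ?R0 \<union> ?R2 \<union> ?R3"
      then consider C D where "x = (f C, f D)" "C \<in> Q" "D \<in> Q" "C \<noteq> D" "p C D"
        | C where "x = (f A, f C)" "C \<in> Q" "p M C" | C where "x = (f C, f A)" "C \<in> Q" "p M C"
        by auto
      then show "x \<in> ?L"
      proof cases
        case 1
        then show ?thesis using f'[of C] f'[of D]
          by (intro CollectI exI[of _ C] exI[of _ D]) simp
      next
        case 2
        then show ?thesis using f'[of C] QP(4)
          by (intro CollectI exI[of _ M] exI[of _ C]) auto
      next
        case 3
        then show ?thesis using f'[of C] QP(4) p[of M C]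
          by (intro CollectI exI[of _ C] exI[of _ M]) auto
      qed
    qed
    also have "?R0 = ?R1"
    proof (intro subset_antisym subsetI)
      fix x assume "x \<in> ?R0"
      then obtain C D where CD: "x = (f C, f D)" "C \<in> Q" "D \<in> Q" "C \<noteq> D" "p C D" by blast
      then have "f C \<notin> {f A, f B}" "f D \<notin> {f A, f B}" using verts by blast+
      then show "x \<in> ?R1" using CD QP(1) by auto
    next
      fix x assume "x \<in> ?R1"
      then obtain C D where CD: "x = (f C, f D)" "C \<in> P" "D \<in> P" "C \<noteq> D" "p C D"
        "{f C, f D} \<inter> {f A, f B} = {}" by blast
      then have "C \<in> Q" "D \<in> Q" by (auto simp: Q_def)
      then show "x \<in> ?R0" using CD by blast
    qed
    finally show ?thesis .
  qed
  have "?f ` Q = f ` Q" by (intro image_cong refl f')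
  then have "?f ` insert M Q = insert ?z (f ` Q)" by (simp only: image_insert fM)
  then show ?thesis
    unfolding contract_def common other verts M_def[symmetric] Q_def[symmetric]
    using split[of "\<lambda>C D. C \<times> D \<subseteq> E", OF symE(1)] split[of "mixed E", OF mixed_sym]
    by (simp add: quotient_trigraph_def)
qed

lemma chain_imp_sequence:
  assumes chain: "chain E V d P Q" and good: "good E V d P" and "sym E" and "choice_on P f"
  shows "\<exists>Hs g. Hs \<noteq> [] \<and> hd Hs = quotient_trigraph E P f \<and> successively contraction_step Hs \<and>
    last Hs = quotient_trigraph E Q g \<and> choice_on Q g \<and> good E V d Q \<and>
    (\<forall>H \<in> set Hs. \<forall>v \<in> tverts H. red_degree H v \<le> d)"
proof -
  have deg: "\<forall>v \<in> tverts (quotient_trigraph E P' f'). red_degree (quotient_trigraph E P' f') v \<le> d"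
    if "good E V d P'" "choice_on P' f'" for P' f'
    using that red_degree_quotient[of V P' f'] unfolding good_def by (auto simp: quotient_trigraph_def)
  show ?thesis
    using chain unfolding chain_def
  proof (induction rule: rtranclp_induct)
    case base
    show ?case
      using deg[OF good assms(4)] good assms(4) by (intro exI[of _ "[quotient_trigraph E P f]"] exI[of _ f]) simp
  next
    case (step P' P'')
    from step.IH obtain Hs g where Hs: "Hs \<noteq> []" "hd Hs = quotient_trigraph E P f"
      "successively contraction_step Hs" "last Hs = quotient_trigraph E P' g" "choice_on P' g" "good E V d P'"
      "\<forall>H \<in> set Hs. \<forall>v \<in> tverts H. red_degree H v \<le> d" by blast
    from step.hyps(2) obtain A B where AB: "A \<in> P'" "B \<in> P'" "A \<noteq> B"
      "P'' = insert (A \<union> B) (P' - {A, B})" and g: "good E V d P''" by (auto simp: merge_def)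
    have P': "partition_on V P'" using Hs(6) by (simp add: good_def)
    define h where "h = g(A \<union> B := g A)"
    have eq: "quotient_trigraph E P'' h = contract (quotient_trigraph E P' g) (g A) (g B) (g A)"
      using contract_quotient[OF P' Hs(5) \<open>sym E\<close> AB(1-3)] AB(4) by (simp add: h_def)
    have "g A \<noteq> g B" using choice_inj_on[OF P' Hs(5)] AB by (auto dest: inj_onD)
    then have "contraction_step (quotient_trigraph E P' g) (quotient_trigraph E P'' h)"
      unfolding contraction_step_def eq using AB by (auto simp: quotient_trigraph_def)
    moreover have h: "choice_on P'' h" using Hs(5) AB by (auto simp: choice_on_def h_def)
    ultimately show ?case
      using Hs deg[OF g h] g
      by (intro exI[of _ "Hs @ [quotient_trigraph E P'' h]"] exI[of _ h])
        (auto simp: successively_append_iff)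
  qed
qed

section \<open>Assembling the bound\<close>

lemma tww_le_of_chain:
  assumes G: "pair_graph G" and "pverts G \<noteq> {}"
    and chain: "chain (parcs G) (pverts G) d (classes id (pverts G)) {pverts G}"
  shows "tww G \<le> d"
proof -
  interpret pair_graph G by (rule G)
  have sym: "sym (parcs G)" using pair_sym_arcs by (simp add: symmetric_def arcs_ends_def)
  have "red_deg (parcs G) (classes id (pverts G)) A = 0" if "A \<in> classes id (pverts G)" for A
  proof -
    have "{B \<in> classes id (pverts G). B \<noteq> A \<and> mixed (parcs G) A B} = {}"
      using that by (auto simp: classes_def mixed_def)
    then show ?thesis unfolding red_deg_def by (simp only: card.empty)
  qed
  then have good: "good (parcs G) (pverts G) d (classes id (pverts G))"
    unfolding good_def using partition_on_classes[of "pverts G" id] by (simp add: classes_id)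
  have "choice_on (classes id (pverts G)) the_elem"
    by (simp add: choice_on_def classes_id)
  from chain_imp_sequence[OF chain good sym this] obtain Hs g where Hs: "Hs \<noteq> []"
    "hd Hs = quotient_trigraph (parcs G) (classes id (pverts G)) the_elem" "successively contraction_step Hs"
    "last Hs = quotient_trigraph (parcs G) {pverts G} g"
    "\<forall>H \<in> set Hs. \<forall>v \<in> tverts H. red_degree H v \<le> d" by blast
  have seq: "contraction_sequence G Hs"
    unfolding contraction_sequence_def
    using Hs quotient_singletons[OF G] by (simp add: quotient_trigraph_def)
  let ?S = "\<Union>H \<in> set Hs. red_degree H ` tverts H"
  have fin: "finite ?S"
  proof (rule finite_subset)
    show "?S \<subseteq> {..d}" using Hs(5) by auto
  qed simp
  have "last Hs \<in> set Hs" using Hs(1) by simp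
  moreover have "tverts (last Hs) \<noteq> {}" unfolding Hs(4) by (simp add: quotient_trigraph_def)
  ultimately have "?S \<noteq> {}" by blast
  then have "max_red_degree Hs \<le> d" unfolding max_red_degree_def using fin Hs(5) by auto
  moreover have "tww G \<le> max_red_degree Hs"
    unfolding tww_def using seq by (intro Least_le) blast
  ultimately show ?thesis by simp
qed

text \<open>Here \<open>b\<close> is the largest bag size, w + 1. Truncated subtraction makes the
  last summand equal to max(w - k - 2, 0).\<close>

lemma tww_le_of_tree_decomposition:
  assumes G: "pair_graph G" and "pverts G \<noteq> {}"
    and td: "tree_decomposition G T B"
  defines "b \<equiv> nat (td_width T B + 1)" and "k \<equiv> td_adhesion T B"
  shows "tww G \<le> 2 ^ k + 2 ^ k div 2 + (b - (k + 3))" (is "_ \<le> ?d")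
proof -
  interpret pair_graph G by (rule G)
  let ?R = "parcs T" and ?E = "parcs G" and ?V = "pverts G"
  have sym: "sym ?E" using pair_sym_arcs by (simp add: symmetric_def arcs_ends_def)
  have fin: "finite ?E" by simp
  have sub: "?E \<subseteq> ?V \<times> ?V" using arc_fst_in_verts arc_snd_in_verts by fastforce
  have T: "undirected_tree (with_proj T)"
    and bag_sub: "\<And>t. t \<in> pverts T \<Longrightarrow> B t \<subseteq> ?V"
    and bag_cover: "\<And>v. v \<in> ?V \<Longrightarrow> \<exists>t \<in> pverts T. v \<in> B t"
    and bag_tree: "\<And>v. v \<in> ?V \<Longrightarrow> undirected_tree (with_proj T \<restriction> {t \<in> pverts T. v \<in> B t})"
    and bag_edge: "\<And>u v. (u, v) \<in> ?E \<Longrightarrow> \<exists>t \<in> pverts T. u \<in> B t \<and> v \<in> B t"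
    using td unfolding tree_decomposition_def by blast+
  note tree = undirected_treeD[OF T]
  have finR: "finite ?R"
  proof -
    interpret T: graph "with_proj T" using T by (simp add: undirected_tree_def)
    show ?thesis using T.finite_arcs by simp
  qed
  have "elimination ?E ?V k b ?R B (pverts T) {}"
  proof
    show "\<exists>t\<in>U. \<forall>p\<in>U. \<forall>q\<in>U. (t, p) \<in> ?R \<longrightarrow> (t, q) \<in> ?R \<longrightarrow> p = q"
      if "U \<subseteq> pverts T" "U \<noteq> {}" for U
    proof (rule exists_low_degree_vertex[OF finite_subset[OF that(1) tree(1)] that(2) tree(4,3)])
      fix xs assume "distinct xs" "3 \<le> length xs" "set xs \<subseteq> U"
        "successively (\<lambda>x y. (x, y) \<in> ?R) xs"
      then show "(last xs, hd xs) \<notin> ?R" using that(1) by (intro tree(6)) simp_all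
    qed
    show "cut_connected ?R {t \<in> pverts T. v \<in> B t}" for v
    proof (cases "v \<in> ?V")
      case True
      then show ?thesis using cut_connected_restrict[OF bag_tree tree(3)] by blast
    next
      case False
      then have "{t \<in> pverts T. v \<in> B t} = {}" using bag_sub by blast
      moreover have "cut_connected ?R {}" by (simp add: cut_connected_def)
      ultimately show ?thesis by (simp only:)
    qed
    show "finite (B t)" if "t \<in> pverts T" for t
      using bag_sub[OF that] by (rule finite_subset) simp
    show "card (B t) \<le> b" if "t \<in> pverts T" for t
    proof -
      have "card (B t) \<le> Max ((\<lambda>t. card (B t)) ` pverts T)"
        using that tree(1) by (intro Max_ge) simp_all
      then show ?thesis unfolding b_def td_width_def by simp
    qed
    show "card (B s \<inter> B t) \<le> k" if "(s, t) \<in> ?R" for s t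
      unfolding k_def td_adhesion_def
    proof (rule Max_ge)
      show "card (B s \<inter> B t) \<in> insert 0 ((\<lambda>(s, t). card (B s \<inter> B t)) ` ?R)"
        by (rule insertI2, rule rev_image_eqI[OF that]) simp
    qed (use finR in simp)
    show "?V = \<Union>{} \<union> \<Union>(B ` pverts T)" using bag_sub bag_cover by auto
    show "\<exists>r\<in>pverts T. u \<in> B r \<and> v \<in> B r" if "(u, v) \<in> ?E" for u v
      using bag_edge[OF that] .
    show "finite ?E" "sym ?E" "?E \<subseteq> ?V \<times> ?V" by fact+
    show "sym ?R" "finite (pverts T)" "pverts T \<noteq> {}" "cut_connected ?R (pverts T)"
      by (fact tree)+
  qed simp_all
  from elimination_complete[OF this] obtain F where F: "finite F"
    "\<forall>Y \<in> F. finite Y \<and> bd ?E Y = {} \<and> reducible ?E ?d Y"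
    "\<forall>Y \<in> F. \<forall>Z \<in> F. Y \<noteq> Z \<longrightarrow> Y \<inter> Z = {}" "?V = \<Union>F"
    by (elim exE conjE) (rule that)
  have "1 \<le> ?d" using one_le_power[of "2::nat" k] by linarith
  have "chain ?E (\<Union>F) ?d (classes id (\<Union>F)) {\<Union>F}"
  proof (rule chain_components[OF fin sym F(1) \<open>1 \<le> ?d\<close>])
    show "?E \<subseteq> \<Union>F \<times> \<Union>F" using sub by (simp only: F(4))
    show "\<Union>F \<noteq> {}" using \<open>pverts G \<noteq> {}\<close> by (simp only: F(4) not_False_eq_True)
    show "Y \<inter> Z = {}" if "Y \<in> F" "Z \<in> F" "Y \<noteq> Z" for Y Z using F(3) that by blast
  qed (use F(2) in blast)+
  then have "chain ?E ?V ?d (classes id ?V) {?V}" by (simp only: F(4))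
  then show ?thesis by (rule tww_le_of_chain[OF G \<open>pverts G \<noteq> {}\<close>])
qed

theorem theorem6:
  fixes G :: "'a pair_pre_digraph"
    and T :: "'t pair_pre_digraph"
    and B :: "'t \<Rightarrow> 'a set"
    and w :: int
    and k :: nat
  assumes "pair_graph G"
    and "pverts G \<noteq> {}"
    and "tree_decomposition G T B"
    and "td_width T B = w"
    and "td_adhesion T B = k"
  shows "real (tww G) \<le> 3 * 2 powr (real k - 1) + max (real_of_int w - real k - 2) 0"
proof -
  let ?b = "nat (w + 1)"
  have "tww G \<le> 2 ^ k + 2 ^ k div 2 + (?b - (k + 3))"
    using tww_le_of_tree_decomposition[OF assms(1-3)] assms(4,5) by simp
  then have "real (tww G) \<le> real (2 ^ k + 2 ^ k div 2 + (?b - (k + 3)))"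
    by (simp only: of_nat_le_iff)
  also have "\<dots> = 2 ^ k + real (2 ^ k div 2) + real (?b - (k + 3))" by simp
  also have "real (?b - (k + 3)) = max (real_of_int w - real k - 2) 0"
    by linarith
  \<comment> \<open>Equality holds for k >= 1. For k = 0 the left side is 0 and the right side 1/2,
    the one case in which the stated bound is not an integer.\<close>
  also have "real (2 ^ k div 2) \<le> 2 ^ k / 2"
  proof -
    have "real (2 * (2 ^ k div 2)) \<le> real (2 ^ k)" by (subst of_nat_le_iff) simp
    then show ?thesis by simp
  qed
  finally show ?thesis
    by (simp add: powr_diff powr_realpow)
qed

end
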